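(* Let $c>1$ be a real number which is not an integer and let $m\ge 2$ be an integer. Let $G$ be a complex valued function defined on $\{0,1,\ldots,m-1\}$. Then for every multiplicative function $f:\mathbb N\to\mathbb C$ with $|f(n)|\le 1$ for all $n$ and \[\sum_{n<N} f(n)=o(N)\qquad (N\to\infty),\] we have \[\sum_{n<N} f(n)\,G\bigl(\lfloor n^c\rfloor \bmod m\bigr)=o(N)\qquad (N\to\infty).\] *)

theory Defs
  imports "HOL-Analysis.Analysis" "HOL-Library.Landau_Symbols"
begin

definition multiplicative_fun :: "(nat \<Rightarrow> complex) \<Rightarrow> bool" where
  "multiplicative_fun f \<longleftrightarrow> f 1 = 1 \<and>
     (\<forall>m n. m > 0 \<longrightarrow> n > 0 \<longrightarrow> coprime m n \<longrightarrow> f (m * n) = f m * f n)"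

end

theory Submission
  imports Defs "HOL-Computational_Algebra.Squarefree"
begin

text \<open>
  Up to an error supported near the endpoints of an arc, the indicator of
  \<open>\<lfloor>n\<^sup>c\<rfloor> mod m = j\<close> is a trigonometric polynomial in \<open>n\<^sup>c / m\<close>, so it suffices to treat
  \<open>\<Sum> f(n) e(k n\<^sup>c / m)\<close> for each integer k. For k = 0 this is the hypothesis on f. For
  k \<open>\<noteq>\<close> 0 the criterion of Katai (Turan-Kubilius plus Cauchy-Schwarz) removes f and leaves
  the correlations \<open>\<Sum> e(k (p\<^sup>c - q\<^sup>c) n\<^sup>c / m)\<close> with distinct primes p and q. Passing to
  trigonometric polynomials first means that only \<open>p\<^sup>c \<noteq> q\<^sup>c\<close> is needed, and no
  information on rational relations between \<open>p\<^sup>c\<close> and \<open>q\<^sup>c\<close>. These sums are o(N):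
  van der Corput differencing, applied \<open>\<lfloor>c\<rfloor>\<close> times, reduces the phase to growth of order
  \<open>n\<^sup>s\<close> with 0 < s < 1, where summation by parts suffices. The same bound shows that few n
  have \<open>n\<^sup>c / m\<close> close to an endpoint modulo 1.
\<close>

section \<open>Sequences with vanishing mean\<close>

text \<open>An explicit form of "the partial sums are o(N)": the constant \<open>B\<close> absorbs
  initial segments, so the bound holds for every \<open>N\<close> and no threshold has to be carried
  through the estimates.\<close>

definition null_mean :: "(nat \<Rightarrow> complex) \<Rightarrow> bool" where
  "null_mean u \<longleftrightarrow> (\<forall>e>0. \<exists>B. \<forall>N. norm (\<Sum>n<N. u n) \<le> e * real N + B)"

lemma null_meanI:
  assumes "\<And>e. e > 0 \<Longrightarrow> \<exists>B. \<forall>N. norm (\<Sum>n<N. u n) \<le> e * real N + B"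
  shows "null_mean u"
  using assms by (auto simp: null_mean_def)

lemma null_meanE:
  assumes "null_mean u" "e > 0"
  obtains B where "B \<ge> 0" "\<And>N. norm (\<Sum>n<N. u n) \<le> e * real N + B"
proof -
  obtain B where B: "\<And>N. norm (\<Sum>n<N. u n) \<le> e * real N + B"
    using assms by (auto simp: null_mean_def)
  from B[of 0] show ?thesis by (intro that[of B] B) auto
qed

lemma null_mean_iff_smallo:
  "null_mean u \<longleftrightarrow> (\<lambda>N. \<Sum>n<N. u n) \<in> o(\<lambda>N. complex_of_real (real N))"
proof
  assume u: "null_mean u"
  show "(\<lambda>N. \<Sum>n<N. u n) \<in> o(\<lambda>N. complex_of_real (real N))"
  proof (rule landau_o.smallI)
    fix e :: real assume "e > 0"
    then obtain B where B: "\<And>N. norm (\<Sum>n<N. u n) \<le> e / 2 * real N + B"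
      using u by (meson half_gt_zero null_meanE)
    have "\<forall>\<^sub>F N in sequentially. real N \<ge> 2 * B / e"
      by (rule filterlim_real_sequentially[unfolded filterlim_at_top, rule_format])
    then show "\<forall>\<^sub>F N in sequentially.
        norm (\<Sum>n<N. u n) \<le> e * norm (complex_of_real (real N))"
    proof eventually_elim
      case (elim N)
      then have "B \<le> e / 2 * real N" using \<open>e > 0\<close> by (simp add: field_simps)
      then show ?case using B[of N] by simp
    qed
  qed
next
  assume u: "(\<lambda>N. \<Sum>n<N. u n) \<in> o(\<lambda>N. complex_of_real (real N))"
  show "null_mean u"
  proof (rule null_meanI)
    fix e :: real assume "e > 0"
    then obtain M where M: "\<And>N. N \<ge> M \<Longrightarrow> norm (\<Sum>n<N. u n) \<le> e * real N"
      using landau_o.smallD[OF u] by (auto simp: eventually_sequentially)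
    have "norm (\<Sum>n<N. u n) \<le> e * real N + (\<Sum>n<M. norm (u n))" for N
    proof (cases "N \<ge> M")
      case True
      have "0 \<le> (\<Sum>n<M. norm (u n))" by (simp add: sum_nonneg)
      then show ?thesis using M[OF True] by linarith
    next
      case False
      have "norm (\<Sum>n<N. u n) \<le> (\<Sum>n<N. norm (u n))" by (rule norm_sum)
      also have "\<dots> \<le> (\<Sum>n<M. norm (u n))" using False by (intro sum_mono2) auto
      finally show ?thesis using \<open>e > 0\<close> by (simp add: add_increasing)
    qed
    then show "\<exists>B. \<forall>N. norm (\<Sum>n<N. u n) \<le> e * real N + B" by blast
  qed
qed

lemma null_mean_0: "null_mean (\<lambda>n. 0)"
  by (auto simp: null_mean_def intro!: exI[of _ 0])

lemma null_mean_add: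
  assumes "null_mean u" "null_mean v"
  shows "null_mean (\<lambda>n. u n + v n)"
proof (rule null_meanI)
  fix e :: real assume "e > 0"
  then have e: "e / 2 > 0" by simp
  obtain B where B: "\<And>N. norm (\<Sum>n<N. u n) \<le> e / 2 * real N + B"
    using null_meanE[OF assms(1) e] by blast
  obtain B' where B': "\<And>N. norm (\<Sum>n<N. v n) \<le> e / 2 * real N + B'"
    using null_meanE[OF assms(2) e] by blast
  have "norm (\<Sum>n<N. u n + v n) \<le> e * real N + (B + B')" for N
    using norm_triangle_ineq[of "\<Sum>n<N. u n" "\<Sum>n<N. v n"] B[of N] B'[of N]
    by (simp add: sum.distrib)
  then show "\<exists>B. \<forall>N. norm (\<Sum>n<N. u n + v n) \<le> e * real N + B" by blast
qed

lemma null_mean_cmult: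
  assumes "null_mean u"
  shows "null_mean (\<lambda>n. c * u n)"
proof (rule null_meanI)
  fix e :: real assume "e > 0"
  define k where "k = norm c + 1"
  have k: "k > 0" "norm c \<le> k" by (auto simp: k_def add_nonneg_pos)
  obtain B where B: "\<And>N. norm (\<Sum>n<N. u n) \<le> e / k * real N + B"
    using null_meanE[OF assms, of "e / k"] \<open>e > 0\<close> k by (metis divide_pos_pos)
  have "norm (\<Sum>n<N. c * u n) \<le> e * real N + k * B" for N
  proof -
    have "norm (\<Sum>n<N. c * u n) = norm c * norm (\<Sum>n<N. u n)"
      by (simp add: sum_distrib_left[symmetric] norm_mult)
    also have "\<dots> \<le> k * (e / k * real N + B)"
      using k B by (intro mult_mono) auto
    also have "\<dots> = e * real N + k * B" using k by (simp add: field_simps)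
    finally show ?thesis .
  qed
  then show "\<exists>B. \<forall>N. norm (\<Sum>n<N. c * u n) \<le> e * real N + B" by blast
qed

lemma null_mean_sum:
  assumes "finite A" "\<And>i. i \<in> A \<Longrightarrow> null_mean (u i)"
  shows "null_mean (\<lambda>n. \<Sum>i\<in>A. u i n)"
  using assms by (induction A rule: finite_induct) (auto simp: null_mean_0 intro: null_mean_add)

text \<open>The approximant \<open>v\<close> may depend on \<open>e\<close>. This is the passage
  from trigonometric polynomials, where cancellation is known, to an indicator that is close to them
  in mean.\<close>

lemma null_mean_approx:
  assumes "\<And>e. e > 0 \<Longrightarrow>
    \<exists>v B. null_mean v \<and> (\<forall>N. (\<Sum>n<N. norm (u n - v n)) \<le> e * real N + B)"
  shows "null_mean u"
proof (rule null_meanI)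
  fix e :: real assume "e > 0"
  then have e: "e / 2 > 0" by simp
  obtain v B where v: "null_mean v"
    and B: "\<And>N. (\<Sum>n<N. norm (u n - v n)) \<le> e / 2 * real N + B"
    using assms[OF e] by blast
  obtain B' where B': "\<And>N. norm (\<Sum>n<N. v n) \<le> e / 2 * real N + B'"
    using null_meanE[OF v e] by blast
  have "norm (\<Sum>n<N. u n) \<le> e * real N + (B + B')" for N
  proof -
    have "norm (\<Sum>n<N. u n) \<le> norm (\<Sum>n<N. u n - v n) + norm (\<Sum>n<N. v n)"
      using norm_triangle_ineq[of "\<Sum>n<N. u n - v n" "\<Sum>n<N. v n"] by (simp add: sum_subtractf)
    moreover have "norm (\<Sum>n<N. u n - v n) \<le> (\<Sum>n<N. norm (u n - v n))" by (rule norm_sum)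
    ultimately show ?thesis using B[of N] B'[of N] by simp
  qed
  then show "\<exists>B. \<forall>N. norm (\<Sum>n<N. u n) \<le> e * real N + B" by blast
qed

lemma null_mean_tendsto_0:
  assumes "u \<longlonglongrightarrow> 0"
  shows "null_mean u"
proof (rule null_mean_approx)
  fix e :: real assume "e > 0"
  then obtain M where M: "\<And>n. n \<ge> M \<Longrightarrow> norm (u n) < e"
    using assms by (auto simp: LIMSEQ_iff)
  have "(\<Sum>n<N. norm (u n)) \<le> e * real N + (\<Sum>n<M. norm (u n))" for N
  proof -
    have "(\<Sum>n<N. norm (u n)) \<le> (\<Sum>n<N. e + (if n < M then norm (u n) else 0))"
      using M \<open>e > 0\<close> by (intro sum_mono) (auto simp: not_less intro: less_imp_le)
    also have "\<dots> = e * real N + (\<Sum>n\<in>{..<N} \<inter> {..<M}. norm (u n))"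
      using sum.inter_restrict[of "{..<N}" "\<lambda>n. norm (u n)" "{..<M}"]
      by (simp add: sum.distrib)
    also have "(\<Sum>n\<in>{..<N} \<inter> {..<M}. norm (u n)) \<le> (\<Sum>n<M. norm (u n))"
      by (intro sum_mono2) auto
    finally show ?thesis by simp
  qed
  then show "\<exists>v B. null_mean v \<and> (\<forall>N. (\<Sum>n<N. norm (u n - v n)) \<le> e * real N + B)"
    by (intro exI[of _ "\<lambda>_. 0"]) (auto simp: null_mean_0)
qed

lemma null_mean_cong_eventually:
  assumes "null_mean u" "\<And>n. n \<ge> M \<Longrightarrow> v n = u n"
  shows "null_mean v"
proof -
  have "(\<lambda>n. v n - u n) \<longlonglongrightarrow> 0"
    using assms(2) by (intro tendsto_eventually eventually_sequentiallyI[of M]) auto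
  from null_mean_add[OF null_mean_tendsto_0[OF this] assms(1)] show ?thesis by simp
qed

text \<open>The two windows differ by \<open>h\<close> terms at either end, each of norm at most
  1.\<close>

lemma norm_sum_shift_diff_le:
  fixes u :: "nat \<Rightarrow> 'a :: real_normed_vector"
  assumes "\<And>n. norm (u n) \<le> 1"
  shows "norm ((\<Sum>n<N. u (n + h)) - (\<Sum>n<N. u n)) \<le> 2 * real h"
proof -
  have "(\<Sum>n<N. u (n + h)) = (\<Sum>n=h..<N+h. u n)"
    by (simp add: sum.shift_bounds_nat_ivl[of u 0 h N, simplified] lessThan_atLeast0)
  also have "\<dots> = (\<Sum>n<N+h. u n) - (\<Sum>n<h. u n)"
    by (simp add: lessThan_atLeast0 sum_diff_nat_ivl)
  also have "(\<Sum>n<N+h. u n) = (\<Sum>n<N. u n) + (\<Sum>n=N..<N+h. u n)"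
    by (simp add: lessThan_atLeast0 sum.atLeastLessThan_concat)
  finally have eq: "(\<Sum>n<N. u (n + h)) - (\<Sum>n<N. u n) = (\<Sum>n=N..<N+h. u n) - (\<Sum>n<h. u n)"
    by simp
  have "norm (\<Sum>n=N..<N+h. u n) \<le> real h"
    using sum_norm_le[of "{N..<N+h}" u "\<lambda>_. 1"] assms by simp
  moreover have "norm (\<Sum>n<h. u n) \<le> real h"
    using sum_norm_le[of "{..<h}" u "\<lambda>_. 1"] assms by simp
  ultimately show ?thesis unfolding eq
    using norm_triangle_ineq4[of "\<Sum>n=N..<N+h. u n" "\<Sum>n<h. u n"] by linarith
qed

lemma null_mean_shift:
  assumes "null_mean u" "\<And>n. norm (u n) \<le> 1"
  shows "null_mean (\<lambda>n. u (n + h))"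
proof (rule null_meanI)
  fix e :: real assume "e > 0"
  then obtain B where B: "\<And>N. norm (\<Sum>n<N. u n) \<le> e * real N + B"
    using null_meanE[OF assms(1)] by blast
  have "norm (\<Sum>n<N. u (n + h)) \<le> e * real N + (B + 2 * real h)" for N
    using norm_sum_shift_diff_le[of u h N, OF assms(2)] B[of N]
      norm_triangle_sub[of "\<Sum>n<N. u (n + h)" "\<Sum>n<N. u n"] by linarith
  then show "\<exists>B. \<forall>N. norm (\<Sum>n<N. u (n + h)) \<le> e * real N + B" by blast
qed

lemma null_mean_cnj:
  assumes "null_mean u"
  shows "null_mean (\<lambda>n. cnj (u n))"
  using assms by (simp add: null_mean_def flip: cnj_sum)

section \<open>Second moments and correlations\<close>

text \<open>Expanding the square and summing over \<open>k\<close> first turns a mean square into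
  correlations. Van der Corput differencing, Katai's criterion and the density bound near a point
  all rest on this.\<close>

lemma sum_norm_sum_square_le:
  fixes a :: "'a \<Rightarrow> 'b \<Rightarrow> complex"
  shows "(\<Sum>k\<in>K. (norm (\<Sum>p\<in>P. a p k))\<^sup>2)
    \<le> (\<Sum>p\<in>P. \<Sum>q\<in>P. norm (\<Sum>k\<in>K. a p k * cnj (a q k)))"
proof -
  have "complex_of_real (\<Sum>k\<in>K. (norm (\<Sum>p\<in>P. a p k))\<^sup>2)
      = (\<Sum>k\<in>K. \<Sum>p\<in>P. \<Sum>q\<in>P. a p k * cnj (a q k))"
    by (simp only: of_real_sum complex_norm_square cnj_sum sum_product)
  also have "\<dots> = (\<Sum>p\<in>P. \<Sum>q\<in>P. \<Sum>k\<in>K. a p k * cnj (a q k))"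
    by (subst sum.swap, intro sum.cong refl sum.swap)
  finally have "norm (complex_of_real (\<Sum>k\<in>K. (norm (\<Sum>p\<in>P. a p k))\<^sup>2))
      = norm (\<Sum>p\<in>P. \<Sum>q\<in>P. \<Sum>k\<in>K. a p k * cnj (a q k))"
    by (rule arg_cong)
  also have "\<dots> \<le> (\<Sum>p\<in>P. norm (\<Sum>q\<in>P. \<Sum>k\<in>K. a p k * cnj (a q k)))"
    by (rule norm_sum)
  also have "\<dots> \<le> (\<Sum>p\<in>P. \<Sum>q\<in>P. norm (\<Sum>k\<in>K. a p k * cnj (a q k)))"
    by (intro sum_mono norm_sum)
  finally show ?thesis
    by (simp only: norm_of_real)
qed

text \<open>Cauchy-Schwarz; its purpose is to discard the bounded weights \<open>b\<close>.\<close>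

lemma norm_sum_mult_square_le:
  fixes b w :: "'a \<Rightarrow> complex"
  assumes "finite K" "\<And>k. k \<in> K \<Longrightarrow> norm (b k) \<le> 1"
  shows "(norm (\<Sum>k\<in>K. b k * w k))\<^sup>2 \<le> real (card K) * (\<Sum>k\<in>K. (norm (w k))\<^sup>2)"
proof -
  have "norm (\<Sum>k\<in>K. b k * w k) \<le> (\<Sum>k\<in>K. norm (w k))"
    using assms by (intro sum_norm_le) (auto simp: norm_mult mult_left_le_one_le)
  then have "(norm (\<Sum>k\<in>K. b k * w k))\<^sup>2 \<le> (\<Sum>k\<in>K. norm (w k))\<^sup>2"
    by (intro power_mono) auto
  also have "\<dots> \<le> (\<Sum>k\<in>K. (norm (w k))\<^sup>2) * real (card K)"
    by (rule sum_squared_le_sum_of_squares)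
  finally show ?thesis by (simp add: mult.commute)
qed

text \<open>Converts a quadratic estimate into the linear shape of \<open>null_mean\<close>. The
  square of the right side contains \<open>4 * A * N^2 + 4 * B * N\<close>, which dominates the
  assumed bound.\<close>

lemma le_linear_of_square_le:
  fixes x A B N :: real
  assumes "A > 0" "B \<ge> 0" "N \<ge> 0" "x\<^sup>2 \<le> N * (A * N + B)"
  shows "x \<le> 2 * sqrt A * N + B / sqrt A"
proof (rule power2_le_imp_le)
  have "(2 * sqrt A * N + B / sqrt A)\<^sup>2 = 4 * (sqrt A)\<^sup>2 * N\<^sup>2 + 4 * B * N + (B / sqrt A)\<^sup>2"
    using assms by (simp add: power2_eq_square field_simps)
  also have "\<dots> = 4 * A * N\<^sup>2 + 4 * B * N + (B / sqrt A)\<^sup>2" using assms by simp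
  also have "\<dots> \<ge> N * (A * N + B)"
    using assms by (simp add: power2_eq_square algebra_simps)
  finally show "x\<^sup>2 \<le> (2 * sqrt A * N + B / sqrt A)\<^sup>2" using assms by linarith
qed (use assms in simp)

text \<open>\<open>E\<close> is added on the diagonal as well; being nonnegative it does no harm
  there, and a full double sum results.\<close>

lemma sum_sum_norm_le_diagonal:
  fixes D :: "'a \<Rightarrow> real"
  assumes "finite P" "\<And>p. p \<in> P \<Longrightarrow> t p p \<le> D p"
    and "\<And>p q. p \<in> P \<Longrightarrow> q \<in> P \<Longrightarrow> p \<noteq> q \<Longrightarrow> t p q \<le> E p q"
    and "\<And>p q. p \<in> P \<Longrightarrow> q \<in> P \<Longrightarrow> E p q \<ge> 0"
  shows "(\<Sum>p\<in>P. \<Sum>q\<in>P. t p q) \<le> sum D P + (\<Sum>p\<in>P. \<Sum>q\<in>P. E p q)"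
proof -
  have "(\<Sum>q\<in>P. t p q) \<le> D p + (\<Sum>q\<in>P. E p q)" if p: "p \<in> P" for p
  proof -
    have "(\<Sum>q\<in>P. t p q) \<le> (\<Sum>q\<in>P. (if q = p then D p else 0) + E p q)"
      using assms(2-) p by (intro sum_mono) (auto intro: add_increasing2)
    also have "\<dots> = D p + (\<Sum>q\<in>P. E p q)"
      using assms(1) p by (simp add: sum.distrib)
    finally show ?thesis .
  qed
  then have "(\<Sum>p\<in>P. \<Sum>q\<in>P. t p q) \<le> (\<Sum>p\<in>P. D p + (\<Sum>q\<in>P. E p q))"
    by (intro sum_mono)
  then show ?thesis by (simp add: sum.distrib)
qed

text \<open>Chooses the additive constants simultaneously, as one function that is nonnegative even
  at excluded pairs, so that they can be summed over a full square.\<close>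

lemma null_mean_off_diagonal:
  assumes "\<And>p q. p \<in> P \<Longrightarrow> q \<in> P \<Longrightarrow> p \<noteq> q \<Longrightarrow> null_mean (u p q)" "d > 0"
  shows "\<exists>B. \<forall>p q. B p q \<ge> 0 \<and>
    (p \<in> P \<and> q \<in> P \<and> p \<noteq> q \<longrightarrow> (\<forall>N. norm (\<Sum>n<N. u p q n) \<le> d * real N + B p q))"
proof -
  have "\<exists>b\<ge>0. p \<in> P \<and> q \<in> P \<and> p \<noteq> q \<longrightarrow> (\<forall>N. norm (\<Sum>n<N. u p q n) \<le> d * real N + b)" for p q
  proof (cases "p \<in> P \<and> q \<in> P \<and> p \<noteq> q")
    case True
    then obtain b where "b \<ge> 0" "\<And>N. norm (\<Sum>n<N. u p q n) \<le> d * real N + b"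
      using null_meanE[OF assms(1) assms(2)] by blast
    then show ?thesis by blast
  qed auto
  then show ?thesis by metis
qed

text \<open>Averaging over \<open>H\<close> shifts changes the sum by a bounded amount.
  Cauchy-Schwarz then leaves \<open>H\<close> diagonal terms of size \<open>N\<close> and small
  off-diagonal correlations, so the sum is of order \<open>N / sqrt H\<close> up to a
  constant.\<close>

lemma van_der_Corput:
  assumes u: "\<And>n. norm (u n) \<le> 1"
    and corr: "\<And>h. h > 0 \<Longrightarrow> null_mean (\<lambda>n. u (n + h) * cnj (u n))"
  shows "null_mean u"
proof (rule null_meanI)
  fix e :: real assume "e > 0"
  \<comment> \<open>The final comparison of \<open>2 * sqrt (2 * H)\<close> with
    \<open>e * H\<close> asks for \<open>H\<close> at least \<open>8 / e^2\<close>; this choice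
    leaves room.\<close>
  obtain H :: nat where H: "real H > 16 / e\<^sup>2 + 1" using reals_Archimedean2 by blast
  then have H0: "real H > 0" using \<open>e > 0\<close> by (smt (verit) divide_nonneg_nonneg zero_le_power2)
  have null: "null_mean (\<lambda>n. u (n + h) * cnj (u (n + h')))" if "h \<noteq> h'" for h h'
  proof -
    have *: "null_mean (\<lambda>n. u (n + h) * cnj (u (n + h')))" if "h' < h" for h h'
      using null_mean_shift[OF corr[of "h - h'"], of h'] that u
      by (simp add: norm_mult mult_le_one add.assoc)
    show ?thesis
    proof (cases "h' < h")
      case False
      then show ?thesis using null_mean_cnj[OF *[of h h']] that by (simp add: mult.commute)
    qed (use * in blast)
  qed
  \<comment> \<open>With slack \<open>1 / H\<close> for each pair, the \<open>H^2\<close> pairs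
    together cost \<open>H * N\<close>, as much as the diagonal.\<close>
  have "1 / real H > 0" using H0 by simp
  then obtain B where *: "\<forall>h h'. B h h' \<ge> 0 \<and> (h \<in> UNIV \<and> h' \<in> UNIV \<and> h \<noteq> h' \<longrightarrow>
      (\<forall>N. norm (\<Sum>n<N. u (n + h) * cnj (u (n + h'))) \<le> 1 / real H * real N + B h h'))"
    using exE[OF null_mean_off_diagonal[of UNIV "\<lambda>h h' n. u (n + h) * cnj (u (n + h'))", OF null]] by blast
  have B0: "B h h' \<ge> 0" for h h' using * by blast
  have B: "h \<noteq> h' \<Longrightarrow> norm (\<Sum>n<N. u (n + h) * cnj (u (n + h'))) \<le> 1 / real H * real N + B h h'" for h h' N
    using * by blast
  define C where "C = (\<Sum>h<H. \<Sum>h'<H. B h h')"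
  have C: "C \<ge> 0" unfolding C_def by (intro sum_nonneg B0)
  have "norm (\<Sum>n<N. u n) \<le> e * real N + (C / sqrt (2 * real H) / real H + 2 * real H)" for N
  proof -
    have "(\<Sum>n<N. (norm (\<Sum>h<H. u (n + h)))\<^sup>2)
        \<le> (\<Sum>h<H. \<Sum>h'<H. norm (\<Sum>n<N. u (n + h) * cnj (u (n + h'))))"
      by (rule sum_norm_sum_square_le)
    also have "\<dots> \<le> (\<Sum>h<H. real N) + (\<Sum>h<H. \<Sum>h'<H. 1 / real H * real N + B h h')"
    proof (rule sum_sum_norm_le_diagonal)
      fix h
      show "norm (\<Sum>n<N. u (n + h) * cnj (u (n + h))) \<le> real N"
        using sum_norm_le[of "{..<N}" "\<lambda>n. u (n + h) * cnj (u (n + h))" "\<lambda>_. 1"] u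
        by (simp add: norm_mult mult_le_one)
    qed (use B B0 in auto)
    also have "\<dots> = 2 * real H * real N + C"
      using H0 by (simp add: sum.distrib C_def)
    finally have sq: "(\<Sum>n<N. (norm (\<Sum>h<H. u (n + h)))\<^sup>2) \<le> 2 * real H * real N + C" .
    have "(norm (\<Sum>n<N. 1 * (\<Sum>h<H. u (n + h))))\<^sup>2
        \<le> real (card {..<N}) * (\<Sum>n<N. (norm (\<Sum>h<H. u (n + h)))\<^sup>2)"
      by (rule norm_sum_mult_square_le) auto
    also have "\<dots> \<le> real N * (2 * real H * real N + C)"
      using mult_left_mono[OF sq, of "real N"] by simp
    finally have "norm (\<Sum>n<N. \<Sum>h<H. u (n + h)) \<le> 2 * sqrt (2 * real H) * real N + C / sqrt (2 * real H)"
      using H0 C by (intro le_linear_of_square_le) auto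
    \<comment> \<open>Replacing a shifted sum by the original costs at most \<open>2 * H\<close>,
      and there are \<open>H\<close> shifts.\<close>
    moreover have "norm (real H * (\<Sum>n<N. u n) - (\<Sum>n<N. \<Sum>h<H. u (n + h))) \<le> real H * (2 * real H)"
    proof -
      have "real H * (\<Sum>n<N. u n) - (\<Sum>n<N. \<Sum>h<H. u (n + h))
          = (\<Sum>h<H. (\<Sum>n<N. u n) - (\<Sum>n<N. u (n + h)))"
        by (simp add: sum_subtractf sum.swap[of _ "{..<N}"])
      also have "norm \<dots> \<le> (\<Sum>h<H. 2 * real H)"
      proof (rule sum_norm_le)
        fix h assume "h \<in> {..<H}"
        then show "norm ((\<Sum>n<N. u n) - (\<Sum>n<N. u (n + h))) \<le> 2 * real H"
          using norm_sum_shift_diff_le[of u h N, OF u] by (simp add: norm_minus_commute)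
      qed
      finally show ?thesis by simp
    qed
    ultimately have "norm (real H * (\<Sum>n<N. u n))
        \<le> 2 * sqrt (2 * real H) * real N + C / sqrt (2 * real H) + real H * (2 * real H)"
      using norm_triangle_sub[of "real H * (\<Sum>n<N. u n)" "\<Sum>n<N. \<Sum>h<H. u (n + h)"] by linarith
    then have "real H * norm (\<Sum>n<N. u n)
        \<le> 2 * sqrt (2 * real H) * real N + C / sqrt (2 * real H) + real H * (2 * real H)"
      by (simp add: norm_mult)
    moreover have "2 * sqrt (2 * real H) \<le> e * real H"
    proof (rule power2_le_imp_le)
      have "8 \<le> e\<^sup>2 * real H" using H \<open>e > 0\<close> by (simp add: field_simps) (smt (verit) zero_less_power)
      then have "8 * real H \<le> (e\<^sup>2 * real H) * real H" by (intro mult_right_mono) auto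
      then show "(2 * sqrt (2 * real H))\<^sup>2 \<le> (e * real H)\<^sup>2"
        by (simp add: power_mult_distrib power2_eq_square mult_ac)
    qed (use \<open>e > 0\<close> in simp)
    then have "2 * sqrt (2 * real H) * real N \<le> e * real H * real N" by (intro mult_right_mono) auto
    ultimately have "real H * norm (\<Sum>n<N. u n)
        \<le> e * real H * real N + C / sqrt (2 * real H) + real H * (2 * real H)" by linarith
    also have "\<dots> = real H * (e * real N + (C / sqrt (2 * real H) / real H + 2 * real H))"
      using H0 by (simp add: algebra_simps)
    finally show ?thesis using H0 by (simp only: mult_le_cancel_left_pos)
  qed
  then show "\<exists>B. \<forall>N. norm (\<Sum>n<N. u n) \<le> e * real N + B" by blast
qed

section \<open>Divergence of the sum of prime reciprocals\<close>

text \<open>\<open>(N + d - 1) div d\<close> is the quotient of \<open>N\<close> by \<open>d\<close>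
  rounded up, which counts the \<open>k\<close> from 0 on with \<open>d * k < N\<close>.\<close>

lemma mult_less_iff_ceiling_div:
  fixes d k N :: nat
  assumes "d > 0"
  shows "d * k < N \<longleftrightarrow> k < (N + d - 1) div d"
proof -
  have "k < (N + d - 1) div d \<longleftrightarrow> Suc k * d \<le> N + d - 1"
    using assms by (simp add: less_eq_div_iff_mult_less_eq Suc_le_eq[symmetric])
  also have "\<dots> \<longleftrightarrow> d * k < N" using assms by (auto simp: algebra_simps)
  finally show ?thesis by simp
qed

lemma Collect_mult_less_eq:
  fixes d N :: nat
  assumes "d > 0"
  shows "{k. d * k < N} = {..<(N + d - 1) div d}"
  using mult_less_iff_ceiling_div[OF assms] by auto

lemma finite_mult_less: "finite {k::nat. d * k < N}" if "d > 0"
  using that by (simp add: Collect_mult_less_eq)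

text \<open>Since \<open>k = 0\<close> is counted, the lower bound carries no error term; the first
  moment in \<open>Turan_Kubilius\<close> relies on this.\<close>

lemma card_mult_less:
  fixes d N :: nat
  assumes "d > 0"
  shows "real N / real d \<le> real (card {k. d * k < N})"
    and "real (card {k. d * k < N}) \<le> real N / real d + 1"
proof -
  define K where "K = (N + d - 1) div d"
  have card: "card {k. d * k < N} = K" using assms by (simp add: Collect_mult_less_eq K_def)
  have "\<not> d * K < N" using mult_less_iff_ceiling_div[OF assms, of K N] by (simp add: K_def)
  then have "real N \<le> real d * real K" by (metis not_less of_nat_le_iff of_nat_mult)
  then show "real N / real d \<le> real (card {k. d * k < N})"
    unfolding card using assms by (simp add: field_simps)
  have "d * K \<le> N + d - 1" by (simp add: K_def)
  then have "d * K \<le> N + d" by linarith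
  then have "real d * real K \<le> real N + real d" by (metis of_nat_add of_nat_le_iff of_nat_mult)
  then show "real (card {k. d * k < N}) \<le> real N / real d + 1"
    unfolding card using assms by (simp add: field_simps)
qed

lemma multiples_eq_image:
  "{n\<in>{..<N}. d dvd n} = (*) d ` {k. d * k < N}" for d N :: nat
  by (auto elim!: dvdE)

lemma card_multiples:
  fixes d N :: nat
  assumes "d > 0"
  shows "real N / real d \<le> real (card {n\<in>{..<N}. d dvd n})"
    and "real (card {n\<in>{..<N}. d dvd n}) \<le> real N / real d + 1"
proof -
  have "card {n\<in>{..<N}. d dvd n} = card {k. d * k < N}"
    unfolding multiples_eq_image using assms by (intro card_image inj_onI) auto
  then show "real N / real d \<le> real (card {n\<in>{..<N}. d dvd n})"
    and "real (card {n\<in>{..<N}. d dvd n}) \<le> real N / real d + 1"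
    using card_mult_less[OF assms, of N] by auto
qed

text \<open>A number is determined by its square part and the primes dividing its squarefree part.\<close>

lemma card_smooth_le:
  fixes P :: "nat set"
  assumes "finite P"
  shows "card {n\<in>{1..R\<^sup>2}. prime_factors n \<subseteq> P} \<le> 2 ^ card P * R"
proof -
  let ?S = "{n\<in>{1..R\<^sup>2}. prime_factors n \<subseteq> P}"
  let ?g = "\<lambda>n::nat. ({p\<in>P. odd (multiplicity p n)}, square_part n)"
  have "inj_on ?g ?S"
  proof (rule inj_onI)
    fix m n assume m: "m \<in> ?S" and n: "n \<in> ?S" and eq: "?g m = ?g n"
    have "odd (multiplicity p m) \<longleftrightarrow> odd (multiplicity p n)" if "prime p" for p
    proof (cases "p \<in> P")
      case True
      then show ?thesis using eq by auto
    next
      case False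
      then have "p \<notin> prime_factors m" "p \<notin> prime_factors n" using m n by auto
      then show ?thesis using that m n by (auto simp: prime_factors_multiplicity)
    qed
    then have "multiplicity p (squarefree_part m) = multiplicity p (squarefree_part n)"
      if "prime p" for p
      using that by (simp add: prime_multiplicity_squarefree_part parity_cases mod_2_eq_odd)
    then have "squarefree_part m = squarefree_part n"
      by (rule multiplicity_eq_nat[rotated 2]) (simp_all only: squarefree_part_nonzero neq0_conv[symmetric] not_False_eq_True)
    moreover have "square_part m = square_part n" using eq by (simp only: prod.inject)
    ultimately show "m = n" by (rule squarefree_decomposition_unique[rotated])
  qed
  moreover have "?g ` ?S \<subseteq> Pow P \<times> {1..R}"
  proof safe
    fix n assume n: "n \<in> {1..R\<^sup>2}"
    then have "(square_part n)\<^sup>2 \<le> n" by (intro dvd_imp_le) auto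
    then have "(square_part n)\<^sup>2 \<le> R\<^sup>2" by (rule order_trans) (use n in simp)
    then have "square_part n \<le> R" by (rule power2_le_imp_le) simp
    moreover have "square_part n \<noteq> 0" using n by simp
    ultimately show "square_part n \<in> {1..R}" by (metis One_nat_def Suc_leI atLeastAtMost_iff neq0_conv)
  qed
  ultimately have "card ?S \<le> card (Pow P \<times> {1..R})"
    using assms by (intro card_inj_on_le) auto
  then show ?thesis using assms by (simp add: card_cartesian_product card_Pow)
qed

text \<open>Supplies the prime sets for Katai's criterion. If the sums were bounded, a finite
  \<open>P\<close> nearly attaining the supremum would leave less than 1/2 to every finite set of
  primes disjoint from it.\<close>

lemma sum_prime_reciprocals_unbounded:
  "\<exists>P. finite P \<and> (\<forall>p\<in>P. prime p) \<and> (\<Sum>p\<in>P. 1 / real p) \<ge> X"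
proof (rule ccontr)
  define Fam where "Fam = {P::nat set. finite P \<and> (\<forall>p\<in>P. prime p)}"
  define s where "s = (\<lambda>P. \<Sum>p\<in>P. 1 / real p)"
  assume "\<not> ?thesis"
  then have bdd: "s P < X" if "P \<in> Fam" for P
    using that by (auto simp: Fam_def s_def not_le)
  have bdd': "bdd_above (s ` Fam)" using bdd by (intro bdd_aboveI[of _ X]) (auto intro: less_imp_le)
  have ne: "s ` Fam \<noteq> {}" by (auto simp: Fam_def)
  obtain P where P: "P \<in> Fam" "s P > Sup (s ` Fam) - 1/2"
    using less_cSup_iff[OF ne bdd', of "Sup (s ` Fam) - 1/2"] by auto
  have tail: "s Q < 1/2" if "Q \<in> Fam" "Q \<inter> P = {}" for Q
  proof -
    have "s (Q \<union> P) \<le> Sup (s ` Fam)" 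
      using P that bdd' by (intro cSup_upper) (auto simp: Fam_def)
    moreover have "s (Q \<union> P) = s Q + s P"
      unfolding s_def using P that by (intro sum.union_disjoint) (auto simp: Fam_def)
    ultimately show ?thesis using P by linarith
  qed
  \<comment> \<open>Erdos: at most half of the numbers up to \<open>R\<^sup>2\<close> have a prime factor outside P; the rest is too sparse.\<close>
  define R :: nat where "R = 2 ^ (card P + 2)"
  define Q where "Q = {p. prime p \<and> p \<le> R\<^sup>2} - P"
  have Q: "Q \<in> Fam" "Q \<inter> P = {}" by (auto simp: Q_def Fam_def)
  have "{1..R\<^sup>2} \<subseteq> {n\<in>{1..R\<^sup>2}. prime_factors n \<subseteq> P} \<union> (\<Union>p\<in>Q. {n\<in>{1..R\<^sup>2}. p dvd n})"
  proof
    fix n assume n: "n \<in> {1..R\<^sup>2}"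
    show "n \<in> {n\<in>{1..R\<^sup>2}. prime_factors n \<subseteq> P} \<union> (\<Union>p\<in>Q. {n\<in>{1..R\<^sup>2}. p dvd n})"
    proof (cases "prime_factors n \<subseteq> P")
      case False
      then obtain p where p: "p \<in> prime_factors n" "p \<notin> P" by auto
      then have "p dvd n" "prime p" by auto
      moreover have "p \<le> R\<^sup>2" using dvd_imp_le[OF \<open>p dvd n\<close>] n by auto
      ultimately show ?thesis using n p by (auto simp: Q_def)
    qed (use n in auto)
  qed
  then have "card {1..R\<^sup>2} \<le> card ({n\<in>{1..R\<^sup>2}. prime_factors n \<subseteq> P} \<union> (\<Union>p\<in>Q. {n\<in>{1..R\<^sup>2}. p dvd n}))"
    using Q by (intro card_mono) (auto simp: Fam_def)
  also have "\<dots> \<le> card {n\<in>{1..R\<^sup>2}. prime_factors n \<subseteq> P} + card (\<Union>p\<in>Q. {n\<in>{1..R\<^sup>2}. p dvd n})"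
    by (rule card_Un_le)
  also have "card (\<Union>p\<in>Q. {n\<in>{1..R\<^sup>2}. p dvd n}) \<le> (\<Sum>p\<in>Q. card {n\<in>{1..R\<^sup>2}. p dvd n})"
    using Q by (intro card_UN_le) (auto simp: Fam_def)
  also have "card {n\<in>{1..R\<^sup>2}. prime_factors n \<subseteq> P} \<le> 2 ^ card P * R"
    using P by (intro card_smooth_le) (auto simp: Fam_def)
  finally have "R\<^sup>2 \<le> 2 ^ card P * R + (\<Sum>p\<in>Q. card {n\<in>{1..R\<^sup>2}. p dvd n})" by simp
  then have "real (R\<^sup>2) \<le> real (2 ^ card P * R + (\<Sum>p\<in>Q. card {n\<in>{1..R\<^sup>2}. p dvd n}))"
    by (rule of_nat_mono)
  also have "\<dots> = real (2 ^ card P * R) + (\<Sum>p\<in>Q. real (card {n\<in>{1..R\<^sup>2}. p dvd n}))" by simp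
  also have "(\<Sum>p\<in>Q. real (card {n\<in>{1..R\<^sup>2}. p dvd n})) \<le> (\<Sum>p\<in>Q. real (R\<^sup>2) * (1 / real p))"
  proof (rule sum_mono)
    fix p assume "p \<in> Q"
    then have p: "p > 0" by (auto simp: Q_def prime_gt_0_nat)
    \<comment> \<open>Leaving out 0 makes the count exactly \<open>R^2 div p\<close>, so no rounding
      error accumulates over \<open>Q\<close>.\<close>
    have "{n\<in>{1..R\<^sup>2}. p dvd n} = {n\<in>{..<R\<^sup>2 + 1}. p dvd n} - {0}" by auto
    then have "card {n\<in>{1..R\<^sup>2}. p dvd n} = card {n\<in>{..<R\<^sup>2 + 1}. p dvd n} - 1" by simp
    moreover have "card {n\<in>{..<R\<^sup>2 + 1}. p dvd n} = card {k. p * k < R\<^sup>2 + 1}"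
      unfolding multiples_eq_image using p by (intro card_image inj_onI) auto
    moreover have "\<dots> = Suc (R\<^sup>2 div p)"
      using p by (simp add: Collect_mult_less_eq)
    ultimately show "real (card {n\<in>{1..R\<^sup>2}. p dvd n}) \<le> real (R\<^sup>2) * (1 / real p)"
      using of_nat_div_le_of_nat[of "R\<^sup>2" p, where ?'a = real] by simp
  qed
  also have "\<dots> = real (R\<^sup>2) * s Q" by (simp add: s_def sum_distrib_left)
  also have "\<dots> \<le> real (R\<^sup>2) * (1/2)" using tail[OF Q] by (intro mult_left_mono) auto
  finally have "real (R\<^sup>2) \<le> real (2 ^ card P * R) + real (R\<^sup>2) * (1/2)" by simp
  then have "real R * real R \<le> 2 * (2 ^ card P * real R)" by (simp add: power2_eq_square)
  then have "real R \<le> 2 * 2 ^ card P" by (simp add: R_def)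
  \<comment> \<open>\<open>R\<close> was taken to be \<open>4 * 2 ^ card P\<close>, twice this
    bound.\<close>
  then show False by (simp add: R_def)
qed

section \<open>Katai's criterion\<close>

text \<open>A variance bound. Divisibility by distinct primes \<open>p\<close> and \<open>q\<close>
  has joint density \<open>1 / (p * q)\<close>, so the covariances cancel up to rounding and the
  diagonal contributes \<open>S * N\<close>.\<close>

lemma Turan_Kubilius:
  fixes P :: "nat set"
  assumes P: "finite P" "\<And>p. p \<in> P \<Longrightarrow> prime p"
  defines "S \<equiv> \<Sum>p\<in>P. 1 / real p"
  shows "(\<Sum>n<N. ((\<Sum>p\<in>P. of_bool (p dvd n)) - S)\<^sup>2) \<le> S * real N + (real (card P))\<^sup>2"
proof -
  define w :: "nat \<Rightarrow> real" where "w = (\<lambda>n. \<Sum>p\<in>P. of_bool (p dvd n))"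
  have pos: "p > 0" if "p \<in> P" for p using P(2)[OF that] by (simp add: prime_gt_0_nat)
  have S0: "S \<ge> 0" by (simp add: S_def sum_nonneg)
  have count: "(\<Sum>n<N. of_bool (d dvd n)) = real (card {n\<in>{..<N}. d dvd n})" for d :: nat
    by (simp add: sum.If_cases of_bool_def Int_def)
  have "(\<Sum>n<N. w n) = (\<Sum>p\<in>P. real (card {n\<in>{..<N}. p dvd n}))"
    unfolding w_def by (subst sum.swap) (simp only: count)
  \<comment> \<open>The first moment enters the variance with the factor \<open>-2 * S\<close>, so
    it has to be bounded from below.\<close>
  also have "\<dots> \<ge> (\<Sum>p\<in>P. real N / real p)"
    by (intro sum_mono card_multiples pos)
  finally have first: "(\<Sum>n<N. w n) \<ge> S * real N"
    by (simp add: S_def sum_distrib_left mult.commute)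
  have "(\<Sum>n<N. (w n)\<^sup>2) = (\<Sum>n<N. \<Sum>p\<in>P. \<Sum>q\<in>P. of_bool (p dvd n) * of_bool (q dvd n))"
    by (simp only: w_def power2_eq_square sum_product)
  also have "\<dots> = (\<Sum>p\<in>P. \<Sum>q\<in>P. \<Sum>n<N. of_bool (p dvd n) * of_bool (q dvd n))"
    by (subst sum.swap, intro sum.cong refl sum.swap)
  also have "\<dots> \<le> (\<Sum>p\<in>P. \<Sum>q\<in>P. real N * (1 / real p) * (1 / real q) + (if q = p then real N * (1 / real p) else 0) + 1)"
  proof (intro sum_mono)
    fix p q assume pq: "p \<in> P" "q \<in> P"
    show "(\<Sum>n<N. of_bool (p dvd n) * of_bool (q dvd n))
        \<le> real N * (1 / real p) * (1 / real q) + (if q = p then real N * (1 / real p) else 0) + 1"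
    proof (cases "q = p")
      case True
      then have "(\<Sum>n<N. of_bool (p dvd n) * of_bool (q dvd n)) = (\<Sum>n<N. of_bool (p dvd n) :: real)"
        by (intro sum.cong) auto
      also have "\<dots> \<le> real N / real p + 1" unfolding count by (intro card_multiples pos pq)
      finally have le: "(\<Sum>n<N. of_bool (p dvd n) * of_bool (q dvd n)) \<le> real N / real p + 1" .
      \<comment> \<open>On the diagonal the product term is merely added, so that one formula serves
        all pairs and its double sum factors as \<open>N * S^2\<close>.\<close>
      have "0 \<le> real N * (1 / real p) * (1 / real q)" by simp
      moreover have "(if q = p then real N * (1 / real p) else 0) = real N / real p" using True by simp
      ultimately show ?thesis using le by linarith
    next
      case False
      then have "coprime p q" using P(2) pq by (simp add: primes_coprime)
      then have iff: "p * q dvd n \<longleftrightarrow> p dvd n \<and> q dvd n" for n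
        by (meson divides_mult dvd_mult_left dvd_mult_right)
      have "(\<Sum>n<N. of_bool (p dvd n) * of_bool (q dvd n)) = (\<Sum>n<N. of_bool (p * q dvd n) :: real)"
        by (simp add: iff of_bool_conj)
      also have "\<dots> \<le> real N / real (p * q) + 1" unfolding count using pos pq by (intro card_multiples) simp
      finally show ?thesis using False by simp
    qed
  qed
  also have "\<dots> = real N * S\<^sup>2 + real N * S + (real (card P))\<^sup>2"
  proof -
    have "(\<Sum>p\<in>P. \<Sum>q\<in>P. real N * (1 / real p) * (1 / real q)) = real N * S\<^sup>2"
      unfolding S_def power2_eq_square sum_product by (simp only: sum_distrib_left mult.assoc)
    moreover have "(\<Sum>p\<in>P. \<Sum>q\<in>P. if q = p then real N * (1 / real p) else 0) = real N * S"
      using P(1) by (simp add: S_def sum_distrib_left)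
    moreover have "(\<Sum>p\<in>P. \<Sum>q\<in>P. 1) = (real (card P))\<^sup>2" by (simp add: power2_eq_square)
    ultimately show ?thesis by (simp only: sum.distrib)
  qed
  finally have second: "(\<Sum>n<N. (w n)\<^sup>2) \<le> real N * S\<^sup>2 + real N * S + (real (card P))\<^sup>2" .
  have "(w n - S)\<^sup>2 = (w n)\<^sup>2 - 2 * S * w n + S\<^sup>2" for n
    by (simp add: power2_diff)
  then have "(\<Sum>n<N. (w n - S)\<^sup>2) = (\<Sum>n<N. (w n)\<^sup>2) - 2 * S * (\<Sum>n<N. w n) + real N * S\<^sup>2"
    by (simp add: sum.distrib sum_subtractf sum_distrib_left)
  also have "\<dots> \<le> real N * S\<^sup>2 + real N * S + (real (card P))\<^sup>2 - 2 * S * (S * real N) + real N * S\<^sup>2"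
    using second mult_left_mono[OF first, of "2 * S"] S0 by simp
  also have "\<dots> = S * real N + (real (card P))\<^sup>2" by (simp add: power2_eq_square algebra_simps)
  finally show ?thesis by (simp add: w_def)
qed

text \<open>The induction carries the sharper bound \<open>2 - 1 / n\<close>, by comparing
  \<open>1 / (n + 1)^2\<close> with the telescoping \<open>1 / n - 1 / (n + 1)\<close>.\<close>

lemma sum_inverse_squares_le:
  fixes P :: "nat set"
  assumes "finite P" "0 \<notin> P"
  shows "(\<Sum>p\<in>P. 1 / real (p * p)) \<le> 2"
proof -
  have "(\<Sum>p=1..n. 1 / real (p * p)) \<le> 2 - 1 / real n" if "n > 0" for n
    using that
  proof (induction n rule: nat_induct_non_zero)
    case (Suc n)
    have "1 / real (Suc n * Suc n) \<le> 1 / real n - 1 / real (Suc n)"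
    proof -
      have "1 / real n - 1 / real (Suc n) = 1 / real (n * Suc n)"
        using Suc.hyps by (simp add: field_simps)
      moreover have "1 / real (Suc n * Suc n) \<le> 1 / real (n * Suc n)"
      proof (rule frac_le)
        have "n * Suc n > 0" using Suc.hyps by simp
        then show "real (n * Suc n) > 0" by (simp only: of_nat_0_less_iff)
        show "real (n * Suc n) \<le> real (Suc n * Suc n)" by (intro of_nat_mono mult_le_mono1) simp
      qed simp_all
      ultimately show ?thesis by simp
    qed
    moreover have "(\<Sum>p=1..Suc n. 1 / real (p * p)) = 1 / real (Suc n * Suc n) + (\<Sum>p=1..n. 1 / real (p * p))"
      by (rule sum.nat_ivl_Suc') simp
    ultimately show ?case using Suc.IH by linarith
  qed simp
  then have le: "(\<Sum>p=1..n. 1 / real (p * p)) \<le> 2" for n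
    by (cases "n = 0") (simp, smt (verit) divide_nonneg_nonneg of_nat_0_le_iff gr0I)
  have "P \<subseteq> {1..Max P}"
    using assms by (auto simp: Suc_le_eq intro!: gr0I)
  then have "(\<Sum>p\<in>P. 1 / real (p * p)) \<le> (\<Sum>p=1..Max P. 1 / real (p * p))"
    by (intro sum_mono2) auto
  then show ?thesis using le[of "Max P"] by linarith
qed

text \<open>With \<open>k\<close> as the outer variable, \<open>F k\<close> is a bounded weight that
  Cauchy-Schwarz removes. The diagonal gives \<open>S * N\<close> and the rest are correlations of
  \<open>g\<close>. The gain is a factor of order \<open>sqrt S\<close> in place of the trivial
  \<open>S\<close>.\<close>

lemma Katai_dilated_sum:
  fixes F g :: "nat \<Rightarrow> complex" and P :: "nat set"
  assumes F: "\<And>n. norm (F n) \<le> 1" and g: "\<And>n. norm (g n) \<le> 1"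
    and P: "finite P" "\<And>p. p \<in> P \<Longrightarrow> prime p" and S: "S = (\<Sum>p\<in>P. 1 / real p)" "S > 0"
    and corr: "\<And>p q. p \<in> P \<Longrightarrow> q \<in> P \<Longrightarrow> p \<noteq> q \<Longrightarrow> null_mean (\<lambda>k. g (p * k) * cnj (g (q * k)))"
  shows "\<exists>B. \<forall>N. norm (\<Sum>p\<in>P. \<Sum>k | p * k < N. F p * F k * g (p * k)) \<le> 2 * sqrt (2 * S) * real N + B"
proof -
  have pos: "p > 0" if "p \<in> P" for p using P(2)[OF that] by (simp add: prime_gt_0_nat)
  define n where "n = real (card P)"
  have n: "n > 0" using P(1) S by (auto simp: n_def card_gt_0_iff)
  \<comment> \<open>This slack, summed over the \<open>n^2\<close> pairs, gives \<open>S * N\<close>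
    and matches the diagonal.\<close>
  have "S / n\<^sup>2 > 0" using S n by simp
  then obtain B where *: "\<forall>p q. B p q \<ge> 0 \<and> (p \<in> P \<and> q \<in> P \<and> p \<noteq> q \<longrightarrow>
      (\<forall>N. norm (\<Sum>k<N. g (p * k) * cnj (g (q * k))) \<le> S / n\<^sup>2 * real N + B p q))"
    using exE[OF null_mean_off_diagonal[of P "\<lambda>p q k. g (p * k) * cnj (g (q * k))", OF corr]] by blast
  have B0: "B p q \<ge> 0" for p q using * by blast
  have B: "p \<in> P \<Longrightarrow> q \<in> P \<Longrightarrow> p \<noteq> q \<Longrightarrow> norm (\<Sum>k<N. g (p * k) * cnj (g (q * k))) \<le> S / n\<^sup>2 * real N + B p q" for p q N
    using * by blast
  define C where "C = n + (\<Sum>p\<in>P. \<Sum>q\<in>P. B p q)"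
  have C: "C \<ge> 0" unfolding C_def using n by (intro add_nonneg_nonneg sum_nonneg B0) auto
  have "norm (\<Sum>p\<in>P. \<Sum>k | p * k < N. F p * F k * g (p * k)) \<le> 2 * sqrt (2 * S) * real N + C / sqrt (2 * S)" for N
  proof (rule le_linear_of_square_le)
    \<comment> \<open>Extension by zero gives every \<open>p\<close> the same range
      \<open>k < N\<close>; the factor \<open>F p\<close> is absorbed as well.\<close>
    define a where "a = (\<lambda>p k. if p * k < N then F p * g (p * k) else 0)"
    have "p * k < N \<Longrightarrow> k < N" if "p \<in> P" for p k
      using pos[OF that] by (metis Suc_leI le_less_trans mult_le_mono1 mult_1 One_nat_def)
    then have set: "{k. p * k < N} = {k\<in>{..<N}. p * k < N}" if "p \<in> P" for p using that by auto
    have "(\<Sum>p\<in>P. \<Sum>k | p * k < N. F p * F k * g (p * k)) = (\<Sum>p\<in>P. \<Sum>k<N. F k * a p k)"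
    proof (rule sum.cong[OF refl])
      fix p assume p: "p \<in> P"
      have "(\<Sum>k | p * k < N. F p * F k * g (p * k)) = (\<Sum>k<N. if p * k < N then F p * F k * g (p * k) else 0)"
        by (simp only: set[OF p] sum.inter_filter[OF finite_lessThan])
      also have "\<dots> = (\<Sum>k<N. F k * a p k)" by (intro sum.cong) (auto simp: a_def)
      finally show "(\<Sum>k | p * k < N. F p * F k * g (p * k)) = (\<Sum>k<N. F k * a p k)" .
    qed
    also have "\<dots> = (\<Sum>k<N. F k * (\<Sum>p\<in>P. a p k))"
      by (subst sum.swap) (simp add: sum_distrib_left)
    finally have "(norm (\<Sum>p\<in>P. \<Sum>k | p * k < N. F p * F k * g (p * k)))\<^sup>2
        \<le> real (card {..<N}) * (\<Sum>k<N. (norm (\<Sum>p\<in>P. a p k))\<^sup>2)"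
      using norm_sum_mult_square_le[of "{..<N}" F "\<lambda>k. \<Sum>p\<in>P. a p k"] F by simp
    also have "(\<Sum>k<N. (norm (\<Sum>p\<in>P. a p k))\<^sup>2) \<le> (\<Sum>p\<in>P. \<Sum>q\<in>P. norm (\<Sum>k<N. a p k * cnj (a q k)))"
      by (rule sum_norm_sum_square_le)
    also have "\<dots> \<le> (\<Sum>p\<in>P. real N / real p + 1) + (\<Sum>p\<in>P. \<Sum>q\<in>P. S / n\<^sup>2 * real N + B p q)"
    proof (rule sum_sum_norm_le_diagonal)
      fix p assume p: "p \<in> P"
      have "norm (\<Sum>k<N. a p k * cnj (a p k)) \<le> (\<Sum>k<N. if p * k < N then 1 else 0)"
        using F g by (intro sum_norm_le) (auto simp: a_def norm_mult intro!: mult_le_one)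
      also have "\<dots> = real (card {k. p * k < N})"
        by (subst set[OF p]) (simp add: sum.If_cases Int_def)
      also have "\<dots> \<le> real N / real p + 1" by (intro card_mult_less pos p)
      finally show "norm (\<Sum>k<N. a p k * cnj (a p k)) \<le> real N / real p + 1" .
    next
      fix p q assume pq: "p \<in> P" "q \<in> P" "p \<noteq> q"
      \<comment> \<open>The constraints for \<open>p\<close> and \<open>q\<close> together say
        \<open>k < K\<close>, with \<open>K\<close> the quotient \<open>N / M\<close> rounded up.
        The correlation thus runs over an initial segment, to which the bound by \<open>B\<close>
        applies.\<close>
      define M where "M = max p q"
      have M: "M > 0" using pos pq by (auto simp: M_def)
      define K where "K = (N + M - 1) div M"
      have KN: "K \<le> N"
      proof -
        have "\<not> N < K" using mult_less_iff_ceiling_div[OF M, of N N] M by (simp add: K_def)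
        then show ?thesis by simp
      qed
      have iff: "p * k < N \<and> q * k < N \<longleftrightarrow> k < K" for k
      proof -
        have "p * k < N \<and> q * k < N \<longleftrightarrow> M * k < N"
        proof (cases "p \<le> q")
          case True
          then have "p * k \<le> q * k" "M = q" by (auto simp: M_def)
          then show ?thesis using le_less_trans by blast
        next
          case False
          then have "q * k \<le> p * k" "M = p" by (auto simp: M_def)
          then show ?thesis using le_less_trans by blast
        qed
        then show ?thesis using mult_less_iff_ceiling_div[OF M, of k N] by (simp add: K_def)
      qed
      have "(\<Sum>k<N. a p k * cnj (a q k)) = (\<Sum>k<N. if k < K then F p * cnj (F q) * (g (p * k) * cnj (g (q * k))) else 0)"
        using iff by (intro sum.cong[OF refl]) (auto simp: a_def)
      also have "\<dots> = (\<Sum>k\<in>{k\<in>{..<N}. k < K}. F p * cnj (F q) * (g (p * k) * cnj (g (q * k))))"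
        by (simp only: sum.inter_filter[OF finite_lessThan])
      also have "{k\<in>{..<N}. k < K} = {..<K}" using KN by auto
      finally have "norm (\<Sum>k<N. a p k * cnj (a q k)) = norm (F p) * norm (F q) * norm (\<Sum>k<K. g (p * k) * cnj (g (q * k)))"
        by (simp add: norm_mult flip: sum_distrib_left)
      also have "\<dots> \<le> 1 * norm (\<Sum>k<K. g (p * k) * cnj (g (q * k)))"
        using F by (intro mult_right_mono mult_le_one) auto
      also have "\<dots> \<le> S / n\<^sup>2 * real K + B p q" using B[OF pq] by simp
      also have "\<dots> \<le> S / n\<^sup>2 * real N + B p q" using KN S n by (intro add_right_mono mult_left_mono) auto
      finally show "norm (\<Sum>k<N. a p k * cnj (a q k)) \<le> S / n\<^sup>2 * real N + B p q" .
    qed (use P B0 S n in auto)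
    also have "\<dots> = 2 * S * real N + C"
    proof -
      have "(\<Sum>p\<in>P. real N / real p + 1) = S * real N + n"
        by (simp add: S(1) sum.distrib n_def sum_distrib_right)
      moreover have "(\<Sum>p\<in>P. \<Sum>q\<in>P. S / n\<^sup>2 * real N + B p q) = n * (n * (S / n\<^sup>2 * real N)) + (\<Sum>p\<in>P. \<Sum>q\<in>P. B p q)"
        by (simp add: sum.distrib n_def)
      moreover have "n * (n * (S / n\<^sup>2 * real N)) = S * real N" using n by (simp add: power2_eq_square)
      ultimately show ?thesis by (simp add: C_def)
    qed
    finally show "(norm (\<Sum>p\<in>P. \<Sum>k | p * k < N. F p * F k * g (p * k)))\<^sup>2 \<le> real N * (2 * S * real N + C)"
      by (simp add: mult_left_mono)
  qed (use S C in auto)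
  then show ?thesis by blast
qed

text \<open>Each \<open>n\<close> is weighted by the number \<open>w n\<close> of its prime divisors
  in \<open>P\<close>, which by Turan-Kubilius is close to \<open>S\<close> on average. Writing
  \<open>n = p * k\<close> and splitting \<open>F (p * k)\<close> leads to the dilated sum. All
  errors are of order \<open>sqrt S * N\<close>, and division by \<open>S\<close> makes them
  small.\<close>

lemma Katai_criterion:
  fixes F g :: "nat \<Rightarrow> complex"
  assumes F: "\<And>n. norm (F n) \<le> 1" and g: "\<And>n. norm (g n) \<le> 1"
    and mult: "\<And>p k. prime p \<Longrightarrow> \<not> p dvd k \<Longrightarrow> F (p * k) = F p * F k"
    and corr: "\<And>p q. prime p \<Longrightarrow> prime q \<Longrightarrow> p \<noteq> q \<Longrightarrow> null_mean (\<lambda>k. g (p * k) * cnj (g (q * k)))"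
  shows "null_mean (\<lambda>n. F n * g n)"
proof (rule null_meanI)
  fix e :: real assume "e > 0"
  \<comment> \<open>The coefficient of \<open>N\<close> met at the end is at most
    \<open>9 * sqrt S\<close>, hence at most \<open>e * S\<close> once \<open>S\<close> reaches
    \<open>(9 / e)^2\<close>. The lower bound 1 lets the constant 4 be absorbed into
    \<open>4 * sqrt S\<close>.\<close>
  obtain P where P: "finite P" "\<And>p. p \<in> P \<Longrightarrow> prime p" and PS: "(\<Sum>p\<in>P. 1 / real p) \<ge> max 1 ((9 / e)\<^sup>2)"
    using sum_prime_reciprocals_unbounded by meson
  define S where "S = (\<Sum>p\<in>P. 1 / real p)"
  have S: "S \<ge> 1" "S \<ge> (9 / e)\<^sup>2" using PS by (auto simp: S_def)
  have pos: "p > 0" if "p \<in> P" for p using P(2)[OF that] by (simp add: prime_gt_0_nat)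
  define n where "n = real (card P)"
  obtain B where B: "\<And>N. norm (\<Sum>p\<in>P. \<Sum>k | p * k < N. F p * F k * g (p * k)) \<le> 2 * sqrt (2 * S) * real N + B"
    using Katai_dilated_sum[of F g P S, OF F g P S_def _ corr[OF P(2) P(2)]] S by auto
  have "norm (\<Sum>n<N. F n * g n) \<le> e * real N + (B + n\<^sup>2 / sqrt S + 2 * n) / S" for N
  proof -
    define w :: "nat \<Rightarrow> real" where "w = (\<lambda>n. \<Sum>p\<in>P. of_bool (p dvd n))"
    have X: "norm (\<Sum>n<N. (F n * g n) * complex_of_real (w n - S)) \<le> 2 * sqrt S * real N + n\<^sup>2 / sqrt S"
    proof (rule le_linear_of_square_le)
      have "(norm (\<Sum>n<N. (F n * g n) * complex_of_real (w n - S)))\<^sup>2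
          \<le> real (card {..<N}) * (\<Sum>n<N. (norm (complex_of_real (w n - S)))\<^sup>2)"
        using F g by (intro norm_sum_mult_square_le) (auto simp: norm_mult mult_le_one)
      also have "\<dots> = real N * (\<Sum>n<N. (w n - S)\<^sup>2)" by (simp only: norm_of_real power2_abs card_lessThan)
      also have "\<dots> \<le> real N * (S * real N + n\<^sup>2)"
        unfolding w_def S_def n_def by (intro mult_left_mono Turan_Kubilius P) auto
      finally show "(norm (\<Sum>n<N. (F n * g n) * complex_of_real (w n - S)))\<^sup>2 \<le> real N * (S * real N + n\<^sup>2)" .
    qed (use S in auto)
    \<comment> \<open>Multiplicativity can fail only when \<open>p\<close> divides \<open>k\<close>,
      that is at multiples of \<open>p^2\<close>, and the sum of \<open>1 / p^2\<close> is bounded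
      uniformly in \<open>P\<close>.\<close>
    have Y: "norm ((\<Sum>p\<in>P. \<Sum>k | p * k < N. F (p * k) * g (p * k)) - (\<Sum>p\<in>P. \<Sum>k | p * k < N. F p * F k * g (p * k)))
        \<le> 4 * real N + 2 * n"
    proof -
      have "norm (\<Sum>k | p * k < N. F (p * k) * g (p * k) - F p * F k * g (p * k)) \<le> 2 * (real N * (1 / real (p * p)) + 1)"
        if p: "p \<in> P" for p
      proof -
        have fin: "finite {k. p * k < N}" using finite_mult_less[OF pos[OF p]] .
        have "norm (F (p * k) * g (p * k) - F p * F k * g (p * k)) \<le> (if p dvd k then 2 else 0)" for k
        proof (cases "p dvd k")
          case True
          have "norm (F (p * k) * g (p * k)) \<le> 1" "norm (F p * F k * g (p * k)) \<le> 1"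
            using F g by (auto simp: norm_mult intro!: mult_le_one)
          then show ?thesis using True norm_triangle_ineq4[of "F (p * k) * g (p * k)" "F p * F k * g (p * k)"] by simp
        qed (use mult P(2)[OF p] in simp)
        then have "norm (\<Sum>k | p * k < N. F (p * k) * g (p * k) - F p * F k * g (p * k))
            \<le> (\<Sum>k | p * k < N. if p dvd k then 2 else 0)"
          by (intro sum_norm_le) auto
        also have "\<dots> = 2 * real (card {k. p * k < N \<and> p dvd k})"
          using fin by (simp add: sum.If_cases Int_def)
        also have "{k. p * k < N \<and> p dvd k} = (*) p ` {j. (p * p) * j < N}"
          by (auto simp: mult.assoc elim!: dvdE)
        also have "card \<dots> = card {j. (p * p) * j < N}"
          using pos[OF p] by (intro card_image inj_onI) auto
        also have "2 * real (card {j. (p * p) * j < N}) \<le> 2 * (real N / real (p * p) + 1)"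
          using pos[OF p] by (intro mult_left_mono card_mult_less) auto
        finally show ?thesis by simp
      qed
      then have "norm (\<Sum>p\<in>P. \<Sum>k | p * k < N. F (p * k) * g (p * k) - F p * F k * g (p * k))
          \<le> (\<Sum>p\<in>P. 2 * (real N * (1 / real (p * p)) + 1))"
        by (intro sum_norm_le)
      also have "\<dots> = 2 * real N * (\<Sum>p\<in>P. 1 / real (p * p)) + 2 * n"
        by (simp add: sum.distrib n_def sum_distrib_left algebra_simps)
      also have "\<dots> \<le> 2 * real N * 2 + 2 * n"
        using P pos by (intro add_right_mono mult_left_mono sum_inverse_squares_le) auto
      finally show ?thesis by (simp add: sum_subtractf)
    qed
    have "(\<Sum>n<N. (F n * g n) * complex_of_real (w n)) = (\<Sum>n<N. \<Sum>p\<in>P. if p dvd n then F n * g n else 0)"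
      by (simp add: w_def sum_distrib_left of_bool_def if_distrib cong: if_cong)
    also have "\<dots> = (\<Sum>p\<in>P. \<Sum>n\<in>{n\<in>{..<N}. p dvd n}. F n * g n)"
      by (subst sum.swap) (simp only: sum.inter_filter[OF finite_lessThan])
    also have "\<dots> = (\<Sum>p\<in>P. \<Sum>k | p * k < N. F (p * k) * g (p * k))"
    proof (rule sum.cong[OF refl])
      fix p assume "p \<in> P"
      then have "inj_on ((*) p) {k. p * k < N}" using pos[of p] by (intro inj_onI) auto
      then show "(\<Sum>n\<in>{n\<in>{..<N}. p dvd n}. F n * g n) = (\<Sum>k | p * k < N. F (p * k) * g (p * k))"
        unfolding multiples_eq_image by (simp add: sum.reindex)
    qed
    finally have Z: "(\<Sum>n<N. (F n * g n) * complex_of_real (w n)) = (\<Sum>p\<in>P. \<Sum>k | p * k < N. F (p * k) * g (p * k))" .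
    have "complex_of_real S * (\<Sum>n<N. F n * g n)
        = (\<Sum>n<N. (F n * g n) * complex_of_real (w n)) - (\<Sum>n<N. (F n * g n) * complex_of_real (w n - S))"
      unfolding sum_distrib_left sum_subtractf[symmetric]
      by (rule sum.cong[OF refl]) (simp add: algebra_simps)
    then have "norm (complex_of_real S * (\<Sum>n<N. F n * g n)) \<le> norm (\<Sum>n<N. (F n * g n) * complex_of_real (w n)) + norm (\<Sum>n<N. (F n * g n) * complex_of_real (w n - S))"
      by (simp only: norm_triangle_ineq4)
    then have "S * norm (\<Sum>n<N. F n * g n) \<le> norm (\<Sum>n<N. (F n * g n) * complex_of_real (w n)) + norm (\<Sum>n<N. (F n * g n) * complex_of_real (w n - S))"
      using S by (simp add: norm_mult)
    also have "norm (\<Sum>n<N. (F n * g n) * complex_of_real (w n)) \<le> (4 * real N + 2 * n) + (2 * sqrt (2 * S) * real N + B)"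
      unfolding Z using Y B[of N] norm_triangle_sub[of "\<Sum>p\<in>P. \<Sum>k | p * k < N. F (p * k) * g (p * k)"
        "\<Sum>p\<in>P. \<Sum>k | p * k < N. F p * F k * g (p * k)"] by linarith
    also note X
    finally have "S * norm (\<Sum>n<N. F n * g n) \<le> (4 + 2 * sqrt (2 * S) + 2 * sqrt S) * real N + (B + n\<^sup>2 / sqrt S + 2 * n)"
      by (simp add: algebra_simps)
    also have "(4 + 2 * sqrt (2 * S) + 2 * sqrt S) * real N \<le> (S * e) * real N"
    proof (rule mult_right_mono)
      have 1: "sqrt S \<ge> 1" using S by simp
      have "sqrt (2 * S) \<le> 3/2 * sqrt S"
      proof -
        have "sqrt 2 \<le> 3/2" by (rule real_le_lsqrt) (simp_all add: power2_eq_square)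
        then show ?thesis unfolding real_sqrt_mult using 1 by (intro mult_right_mono) auto
      qed
      then have "4 + 2 * sqrt (2 * S) + 2 * sqrt S \<le> 9 * sqrt S" using 1 by linarith
      also have "9 \<le> sqrt S * e"
        using real_le_rsqrt[OF S(2)] \<open>e > 0\<close> by (simp add: field_simps)
      then have "9 * sqrt S \<le> (sqrt S * e) * sqrt S" using 1 by (intro mult_right_mono) auto
      also have "\<dots> = S * e" using S by simp
      finally show "4 + 2 * sqrt (2 * S) + 2 * sqrt S \<le> S * e" by simp
    qed simp
    also have "S * e * real N + (B + n\<^sup>2 / sqrt S + 2 * n) = S * (e * real N + (B + n\<^sup>2 / sqrt S + 2 * n) / S)"
    proof -
      have "S * (K / S) = K" for K using S by simp
      then show ?thesis by (simp only: distrib_left mult.assoc)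
    qed
    finally have "S * norm (\<Sum>n<N. F n * g n) \<le> S * (e * real N + (B + n\<^sup>2 / sqrt S + 2 * n) / S)" by simp
    moreover have "0 < S" using S by simp
    ultimately show ?thesis by (simp only: mult_le_cancel_left_pos)
  qed
  then show "\<exists>B. \<forall>N. norm (\<Sum>n<N. F n * g n) \<le> e * real N + B" by blast
qed

section \<open>Exponential sums over powers\<close>

text \<open>Differencing in a real variable gives access to the mean value theorem;
  \<open>sdiff\<close> is the same operator on sequences, where the phases live.\<close>

definition fdiff :: "(real \<Rightarrow> real) \<Rightarrow> real \<Rightarrow> real" where
  "fdiff f x = f (x + 1) - f x"

definition sdiff :: "(nat \<Rightarrow> real) \<Rightarrow> nat \<Rightarrow> real" where
  "sdiff a n = a (Suc n) - a n"

lemma fdiff_powr_deriv: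
  assumes "x > 0"
  shows "((fdiff ^^ k) (\<lambda>x. x powr c) has_real_derivative c * (fdiff ^^ k) (\<lambda>x. x powr (c - 1)) x) (at x)"
  using assms
proof (induction k arbitrary: x)
  case 0
  then show ?case by (auto intro!: derivative_eq_intros)
next
  case (Suc k)
  have 1: "((fdiff ^^ k) (\<lambda>x. x powr c) has_real_derivative c * (fdiff ^^ k) (\<lambda>x. x powr (c - 1)) x) (at x)"
    using Suc by blast
  have "((fdiff ^^ k) (\<lambda>x. x powr c) has_real_derivative c * (fdiff ^^ k) (\<lambda>x. x powr (c - 1)) (x + 1)) (at (x + 1))"
    using Suc by simp
  then have 2: "((\<lambda>y. (fdiff ^^ k) (\<lambda>x. x powr c) (y + 1)) has_real_derivative c * (fdiff ^^ k) (\<lambda>x. x powr (c - 1)) (x + 1)) (at x)"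
    by (simp add: DERIV_shift)
  show ?case using DERIV_diff[OF 2 1] by (simp add: fdiff_def[abs_def] algebra_simps)
qed

text \<open>The mean value theorem trades one difference for one derivative: the next difference of
  \<open>x powr c\<close> is \<open>c\<close> times the \<open>k\<close>-th difference of
  \<open>x powr (c - 1)\<close> at a point between \<open>x\<close> and \<open>x + 1\<close>. The
  exponent changes, so the induction is over all \<open>c\<close>.\<close>

lemma fdiff_powr_asymp:
  "((\<lambda>x. (fdiff ^^ k) (\<lambda>x. x powr c) x / x powr (c - real k)) \<longlongrightarrow> (\<Prod>i<k. c - real i)) at_top"
proof (induction k arbitrary: c)
  case 0
  have "\<forall>\<^sub>F x in at_top. x powr c / x powr c = (1::real)"
    using eventually_gt_at_top[of "0::real"] by eventually_elim auto
  then show ?case by (simp add: tendsto_eventually)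
next
  case (Suc k)
  let ?D = "\<lambda>k c. (fdiff ^^ k) (\<lambda>x. x powr c)"
  have "\<exists>z. x > 0 \<longrightarrow> x < z \<and> z < x + 1 \<and> ?D (Suc k) c x = c * ?D k (c - 1) z" for x :: real
  proof (cases "x > 0")
    case True
    have "\<exists>z>x. z < x + 1 \<and> ?D k c (x + 1) - ?D k c x = (x + 1 - x) * (c * ?D k (c - 1) z)"
      using True by (intro MVT2 fdiff_powr_deriv) auto
    then show ?thesis by (auto simp: fdiff_def)
  qed auto
  then obtain z where z: "\<And>x. x > 0 \<Longrightarrow> x < z x \<and> z x < x + 1 \<and> ?D (Suc k) c x = c * ?D k (c - 1) (z x)"
    by metis
  have lim: "filterlim z at_top at_top"
  proof (rule filterlim_at_top_mono[OF filterlim_ident])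
    show "\<forall>\<^sub>F x in at_top. x \<le> z x"
      using eventually_gt_at_top[of "0::real"] by eventually_elim (use z in \<open>auto intro: less_imp_le\<close>)
  qed
  have quot: "((\<lambda>x. z x / x) \<longlongrightarrow> 1) at_top"
  proof (rule tendsto_sandwich)
    show "\<forall>\<^sub>F x in at_top. 1 \<le> z x / x" "\<forall>\<^sub>F x in at_top. z x / x \<le> 1 + inverse x"
      using eventually_gt_at_top[of "0::real"]
      by (eventually_elim, use z in \<open>fastforce simp: field_simps\<close>)+
    show "((\<lambda>x::real. 1 + inverse x) \<longlongrightarrow> 1) at_top"
      using tendsto_add[OF tendsto_const tendsto_inverse_0_at_top[OF filterlim_ident], of 1] by simp
  qed auto
  have "((\<lambda>x. c * (?D k (c - 1) (z x) / z x powr (c - 1 - real k)) * (z x / x) powr (c - 1 - real k))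
      \<longlongrightarrow> c * (\<Prod>i<k. c - 1 - real i) * 1 powr (c - 1 - real k)) at_top"
    by (intro tendsto_intros quot filterlim_compose[OF Suc.IH lim]) auto
  moreover have "\<forall>\<^sub>F x in at_top. c * (?D k (c - 1) (z x) / z x powr (c - 1 - real k)) * (z x / x) powr (c - 1 - real k)
      = ?D (Suc k) c x / x powr (c - real (Suc k))"
    using eventually_gt_at_top[of "0::real"]
  proof eventually_elim
    case (elim x)
    then have "z x > 0" using z[of x] by simp
    have e: "c - real (Suc k) = c - 1 - real k" by simp
    show ?case using z[OF elim] elim \<open>z x > 0\<close> unfolding e by (simp add: powr_divide)
  qed
  ultimately have "((\<lambda>x. ?D (Suc k) c x / x powr (c - real (Suc k))) \<longlongrightarrow> c * (\<Prod>i<k. c - 1 - real i) * 1 powr (c - 1 - real k)) at_top"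
    by (rule Lim_transform_eventually)
  moreover have "c * (\<Prod>i<k. c - 1 - real i) * 1 powr (c - 1 - real k) = (\<Prod>i<Suc k. c - real i)"
    by (subst prod.lessThan_Suc_shift) (simp add: algebra_simps)
  ultimately show ?case by simp
qed

section \<open>Iterated differences of sequences\<close>

lemma sdiff_funpow_of_real:
  "(sdiff ^^ k) (\<lambda>n. b * f (real n)) n = b * (fdiff ^^ k) f (real n)"
  by (induction k arbitrary: n) (auto simp: sdiff_def fdiff_def algebra_simps)

lemma sdiff_powr_asymp:
  "(\<lambda>n. (sdiff ^^ k) (\<lambda>n. b * real n powr c) n / real n powr (c - real k)) \<longlonglongrightarrow> b * (\<Prod>i<k. c - real i)"
proof -
  have "(\<lambda>n. b * ((fdiff ^^ k) (\<lambda>x. x powr c) (real n) / real n powr (c - real k))) \<longlonglongrightarrow> b * (\<Prod>i<k. c - real i)"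
    by (intro tendsto_intros filterlim_compose[OF fdiff_powr_asymp filterlim_real_sequentially])
  then show ?thesis by (simp add: sdiff_funpow_of_real[of k b "\<lambda>x. x powr c"])
qed

lemma sdiff_funpow_shift: "(sdiff ^^ k) (\<lambda>n. a (n + h)) n = (sdiff ^^ k) a (n + h)"
  by (induction k arbitrary: n) (auto simp: sdiff_def)

lemma sdiff_funpow_diff: "(sdiff ^^ k) (\<lambda>n. a n - b n) n = (sdiff ^^ k) a n - (sdiff ^^ k) b n"
  by (induction k arbitrary: n) (auto simp: sdiff_def)

text \<open>An increment over \<open>h\<close> steps telescopes into \<open>h\<close> unit
  differences, which is why one van der Corput step uses up one order of differencing.\<close>

lemma sdiff_funpow_increment:
  "(sdiff ^^ k) (\<lambda>n. a (n + h) - a n) n = (\<Sum>i<h. (sdiff ^^ Suc k) a (n + i))"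
proof -
  have "(\<Sum>i<h. (sdiff ^^ Suc k) a (n + i)) = (\<Sum>i<h. (sdiff ^^ k) a (n + Suc i) - (sdiff ^^ k) a (n + i))"
    by (simp add: sdiff_def)
  also have "\<dots> = (sdiff ^^ k) a (n + h) - (sdiff ^^ k) a n"
    by (subst sum_lessThan_telescope) simp
  finally show ?thesis by (simp add: sdiff_funpow_diff sdiff_funpow_shift)
qed

lemma tendsto_powr_shift_quotient:
  "(\<lambda>n. real (n + i) powr r / real n powr r) \<longlonglongrightarrow> 1"
proof -
  have "(\<lambda>n. 1 + real i / real n) \<longlonglongrightarrow> 1 + 0"
    by (intro tendsto_intros lim_const_over_n)
  moreover have "\<forall>\<^sub>F n in sequentially. 1 + real i / real n = real (n + i) / real n"
    using eventually_gt_at_top[of 0] by eventually_elim (simp add: field_simps)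
  ultimately have "(\<lambda>n. real (n + i) / real n) \<longlonglongrightarrow> 1"
    by (simp add: Lim_transform_eventually)
  then have "(\<lambda>n. (real (n + i) / real n) powr r) \<longlonglongrightarrow> 1 powr r"
    by (intro tendsto_intros) auto
  then show ?thesis by (simp add: powr_divide)
qed

lemma sdiff_increment_asymp:
  assumes "(\<lambda>n. (sdiff ^^ Suc k) a n / real n powr r) \<longlonglongrightarrow> C"
  shows "(\<lambda>n. (sdiff ^^ k) (\<lambda>n. a (n + h) - a n) n / real n powr r) \<longlonglongrightarrow> real h * C"
proof -
  have "(\<lambda>n. \<Sum>i<h. ((sdiff ^^ Suc k) a (n + i) / real (n + i) powr r) * (real (n + i) powr r / real n powr r))
      \<longlonglongrightarrow> (\<Sum>i<h. C * 1)"
    by (intro tendsto_sum tendsto_mult tendsto_powr_shift_quotient LIMSEQ_ignore_initial_segment[OF assms])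
  moreover have "\<forall>\<^sub>F n in sequentially.
      (\<Sum>i<h. ((sdiff ^^ Suc k) a (n + i) / real (n + i) powr r) * (real (n + i) powr r / real n powr r))
      = (sdiff ^^ k) (\<lambda>n. a (n + h) - a n) n / real n powr r"
    using eventually_gt_at_top[of 0]
  proof eventually_elim
    case (elim n)
    then show ?case
      by (simp add: sdiff_funpow_increment sum_divide_distrib del: funpow.simps)
  qed
  ultimately show ?thesis by (simp add: Lim_transform_eventually)
qed

text \<open>Partial summation moves the difference onto \<open>v\<close>. The boundary term
  \<open>v N\<close> is itself bounded by \<open>norm (v 0)\<close> plus the total variation of
  \<open>v\<close> up to \<open>N\<close>, which is o(N).\<close>

lemma null_mean_summation_by_parts:
  assumes u: "\<And>n. norm (u n) \<le> 1"
    and uv: "\<And>n. n \<ge> M \<Longrightarrow> u n = (u (Suc n) - u n) * v n"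
    and v: "(\<lambda>n. v (Suc n) - v n) \<longlonglongrightarrow> 0"
  shows "null_mean u"
proof -
  have null: "null_mean (\<lambda>n. complex_of_real (norm (v (Suc n) - v n)))"
    using tendsto_norm[OF v] by (intro null_mean_tendsto_0 tendsto_of_real[where ?a=0, simplified]) simp
  define u' where "u' = (\<lambda>n. (u (Suc n) - u n) * v n)"
  have "null_mean u'"
  proof (rule null_meanI)
    fix e :: real assume "e > 0"
    then obtain B where B: "\<And>N. norm (\<Sum>n<N. complex_of_real (norm (v (Suc n) - v n))) \<le> e / 2 * real N + B"
      using null_meanE[OF null, of "e/2"] by auto
    have B': "(\<Sum>n<N. norm (v (Suc n) - v n)) \<le> e / 2 * real N + B" for N
      using B[of N] by (simp flip: of_real_sum add: abs_of_nonneg sum_nonneg)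
    have "norm (\<Sum>n<N. u' n) \<le> e * real N + (2 * B + 2 * norm (v 0))" for N
    proof -
      have "(\<Sum>n<N. u' n) = u N * v N - u 0 * v 0 - (\<Sum>n<N. u (Suc n) * (v (Suc n) - v n))"
        by (induction N) (auto simp: u'_def algebra_simps)
      moreover have "norm (\<Sum>n<N. u (Suc n) * (v (Suc n) - v n)) \<le> (\<Sum>n<N. norm (v (Suc n) - v n))"
        using u by (intro sum_norm_le) (auto simp: norm_mult mult_left_le_one_le)
      moreover have "norm (v N) \<le> norm (v 0) + (\<Sum>n<N. norm (v (Suc n) - v n))"
      proof -
        have eq: "v N = v 0 + (\<Sum>n<N. v (Suc n) - v n)" by (simp add: sum_lessThan_telescope)
        show ?thesis by (subst eq, rule norm_triangle_le) (simp add: norm_sum)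
      qed
      moreover have "norm (u N * v N) \<le> norm (v N)" "norm (u 0 * v 0) \<le> norm (v 0)"
        using u by (auto simp: norm_mult mult_left_le_one_le)
      moreover have "norm (x - y - w) \<le> norm x + norm y + norm w" for x y w :: complex
        using norm_triangle_ineq4[of x y] norm_triangle_ineq4[of "x - y" w] by linarith
      ultimately show ?thesis using B'[of N] by (smt (verit) field_sum_of_halves mult_minus_left distrib_right)
    qed
    then show "\<exists>B. \<forall>N. norm (\<Sum>n<N. u' n) \<le> e * real N + B" by blast
  qed
  then show ?thesis by (rule null_mean_cong_eventually[of _ M]) (use uv in \<open>simp add: u'_def\<close>)
qed

lemma norm_cis_diff_le: "norm (cis x - cis y) \<le> \<bar>x - y\<bar>"
proof -
  have "norm (cis x - cis y) = norm (cis y) * norm (cis (x - y) - 1)"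
    by (simp add: norm_mult[symmetric] algebra_simps cis_mult del: norm_cis)
  also have "\<dots> = 2 * \<bar>sin ((x - y) / 2)\<bar>" by (simp only: cis_conv_exp dist_exp_i_1) simp
  also have "\<dots> \<le> \<bar>x - y\<bar>" using abs_sin_x_le_abs_x[of "(x - y) / 2"] by simp
  finally show ?thesis .
qed

text \<open>Summation by parts with \<open>v n = 1 / (cis (sdiff a n) - 1)\<close>. Its increments
  are at most of order \<open>n powr (s - 2) / n powr (2 * (s - 1)) = n powr (- s)\<close>, which
  tends to 0.\<close>

lemma null_mean_cis_slow:
  assumes s: "0 < s" "s < 1" and C: "C \<noteq> 0"
    and D1: "(\<lambda>n. sdiff a n / real n powr (s - 1)) \<longlonglongrightarrow> C"
    and D2: "(\<lambda>n. sdiff (sdiff a) n / real n powr (s - 2)) \<longlonglongrightarrow> C'"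
  shows "null_mean (\<lambda>n. cis (a n))"
proof -
  define d where "d = sdiff a"
  define w where "w = (\<lambda>n. cis (d n) - 1)"
  have d0: "d \<longlonglongrightarrow> 0"
  proof -
    have "(\<lambda>n. (d n / real n powr (s - 1)) * real n powr (s - 1)) \<longlonglongrightarrow> C * 0"
      unfolding d_def using s by (intro tendsto_mult D1 tendsto_neg_powr filterlim_real_sequentially) auto
    moreover have "\<forall>\<^sub>F n in sequentially. (d n / real n powr (s - 1)) * real n powr (s - 1) = d n"
      using eventually_gt_at_top[of 0] by eventually_elim auto
    ultimately show ?thesis by (simp add: Lim_transform_eventually)
  qed
  have d_ne: "\<forall>\<^sub>F n in sequentially. d n \<noteq> 0"
    using tendsto_imp_eventually_ne[OF D1 C] by eventually_elim (auto simp: d_def)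
  have "filterlim (\<lambda>n. \<i> * complex_of_real (d n)) (at 0) sequentially"
    using tendsto_mult[OF tendsto_const tendsto_of_real[OF d0], of \<i>] d_ne
    by (auto simp: filterlim_at)
  then have "(\<lambda>n. \<i> * ((exp (\<i> * complex_of_real (d n)) - 1) / (\<i> * complex_of_real (d n)))) \<longlonglongrightarrow> \<i> * 1"
    by (intro tendsto_intros filterlim_compose[OF lim_exp_minus_1])
  then have wd: "(\<lambda>n. w n / complex_of_real (d n)) \<longlonglongrightarrow> \<i>"
    by (simp add: w_def cis_conv_exp)
  have "(\<lambda>n. (w n / complex_of_real (d n)) * complex_of_real (d n / real n powr (s - 1))) \<longlonglongrightarrow> \<i> * complex_of_real C"
    using D1 by (intro tendsto_mult wd tendsto_of_real) (simp add: d_def)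
  moreover have "\<forall>\<^sub>F n in sequentially. (w n / complex_of_real (d n)) * complex_of_real (d n / real n powr (s - 1)) = w n / complex_of_real (real n powr (s - 1))"
    using d_ne by eventually_elim auto
  ultimately have w1: "(\<lambda>n. w n / complex_of_real (real n powr (s - 1))) \<longlonglongrightarrow> \<i> * complex_of_real C"
    by (rule Lim_transform_eventually)
  have w_ne: "\<forall>\<^sub>F n in sequentially. w n \<noteq> 0"
    using tendsto_imp_eventually_ne[OF w1, of 0] C by (auto elim: eventually_mono)
  have "(\<lambda>n. sdiff d n / real n powr (s - 2) * real n powr (-s)) \<longlonglongrightarrow> C' * 0"
    unfolding d_def using s by (intro tendsto_mult D2 tendsto_neg_powr filterlim_real_sequentially) auto
  then have num: "(\<lambda>n. sdiff d n / (real n powr (s - 1) * real n powr (s - 1))) \<longlonglongrightarrow> 0"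
  proof -
    have "sdiff d n / real n powr (s - 2) * real n powr (-s) = sdiff d n / (real n powr (s - 1) * real n powr (s - 1))" for n
      by (simp add: powr_add[symmetric] powr_minus divide_simps)
    then show ?thesis
      using \<open>(\<lambda>n. sdiff d n / real n powr (s - 2) * real n powr (-s)) \<longlonglongrightarrow> C' * 0\<close> by simp
  qed
  have num': "(\<lambda>n. (w n - w (Suc n)) / complex_of_real (real n powr (s - 1) * real n powr (s - 1))) \<longlonglongrightarrow> 0"
  proof (rule Lim_null_comparison[OF _ tendsto_rabs_zero[OF num]])
    have "norm (w n - w (Suc n)) \<le> \<bar>sdiff d n\<bar>" for n
      using norm_cis_diff_le[of "d n" "d (Suc n)"] by (simp add: w_def sdiff_def)
    then show "\<forall>\<^sub>F n in sequentially. norm ((w n - w (Suc n)) / complex_of_real (real n powr (s - 1) * real n powr (s - 1)))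
       \<le> \<bar>sdiff d n / (real n powr (s - 1) * real n powr (s - 1))\<bar>"
      by (intro always_eventually allI) (simp add: norm_divide norm_mult divide_right_mono)
  qed
  have w2: "(\<lambda>n. w (Suc n) / complex_of_real (real n powr (s - 1))) \<longlonglongrightarrow> \<i> * complex_of_real C"
  proof -
    have "(\<lambda>n. w (n + 1) / complex_of_real (real (n + 1) powr (s - 1)) * complex_of_real (real (n + 1) powr (s - 1) / real n powr (s - 1)))
        \<longlonglongrightarrow> \<i> * complex_of_real C * complex_of_real 1"
      by (intro tendsto_mult tendsto_of_real tendsto_powr_shift_quotient LIMSEQ_ignore_initial_segment[OF w1])
    moreover have "w (n + 1) / complex_of_real (real (n + 1) powr (s - 1)) * complex_of_real (real (n + 1) powr (s - 1) / real n powr (s - 1))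
       = w (Suc n) / complex_of_real (real n powr (s - 1))" for n
      by simp
    ultimately show ?thesis by simp
  qed
  \<comment> \<open>This is the difference of the reciprocals of \<open>w (Suc n)\<close> and
    \<open>w n\<close> over a common denominator, with numerator and denominator normalised by the
    same power of \<open>n\<close>.\<close>
  have "(\<lambda>n. (w n - w (Suc n)) / complex_of_real (real n powr (s - 1) * real n powr (s - 1))
        / (w n / complex_of_real (real n powr (s - 1)) * (w (Suc n) / complex_of_real (real n powr (s - 1)))))
      \<longlonglongrightarrow> 0 / (\<i> * complex_of_real C * (\<i> * complex_of_real C))"
    using C by (intro tendsto_divide tendsto_mult w1 w2 num') auto
  moreover have "\<forall>\<^sub>F n in sequentially. (w n - w (Suc n)) / complex_of_real (real n powr (s - 1) * real n powr (s - 1))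
        / (w n / complex_of_real (real n powr (s - 1)) * (w (Suc n) / complex_of_real (real n powr (s - 1))))
      = inverse (w (Suc n)) - inverse (w n)"
    using w_ne eventually_compose_filterlim[OF w_ne filterlim_Suc] eventually_gt_at_top[of 0]
    by eventually_elim (simp add: field_simps)
  ultimately have v: "(\<lambda>n. inverse (w (Suc n)) - inverse (w n)) \<longlonglongrightarrow> 0"
    by (simp add: Lim_transform_eventually)
  obtain M where M: "\<And>n. n \<ge> M \<Longrightarrow> w n \<noteq> 0" using w_ne by (auto simp: eventually_sequentially)
  show ?thesis
  proof (rule null_mean_summation_by_parts[OF _ _ v])
    fix n assume "n \<ge> M"
    have "cis (a (Suc n)) - cis (a n) = cis (a n) * w n"
      by (simp add: w_def d_def sdiff_def algebra_simps cis_mult)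
    then show "cis (a n) = (cis (a (Suc n)) - cis (a n)) * inverse (w n)" using M[OF \<open>n \<ge> M\<close>] by simp
  qed simp
qed

text \<open>Each van der Corput step lowers the order of differencing by one, keeps the exponents,
  and multiplies \<open>C\<close> by \<open>h > 0\<close>, so the constant stays nonzero. Two
  consecutive orders are carried because the slow case at the end uses both.\<close>

lemma null_mean_cis_sdiff:
  assumes "0 < s" "s < 1" "C \<noteq> 0"
    and "(\<lambda>n. (sdiff ^^ Suc d) a n / real n powr (s - 1)) \<longlonglongrightarrow> C"
    and "(\<lambda>n. (sdiff ^^ Suc (Suc d)) a n / real n powr (s - 2)) \<longlonglongrightarrow> C'"
  shows "null_mean (\<lambda>n. cis (a n))"
  using assms(3-)
proof (induction d arbitrary: a C C')
  case 0
  then show ?case using null_mean_cis_slow[OF assms(1,2)] by simp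
next
  case (Suc d)
  show ?case
  proof (rule van_der_Corput)
    fix h :: nat assume h: "h > 0"
    have "null_mean (\<lambda>n. cis (a (n + h) - a n))"
    proof (rule Suc.IH)
      show "real h * C \<noteq> 0" using h Suc.prems by simp
    qed (use sdiff_increment_asymp Suc.prems in blast)+
    then show "null_mean (\<lambda>n. cis (a (n + h)) * cnj (cis (a n)))"
      by (simp add: cis_cnj cis_mult)
  qed simp
qed

lemma null_mean_cis_powr:
  assumes c: "c > 1" "c \<notin> \<int>" and b: "b \<noteq> 0"
  shows "null_mean (\<lambda>n. cis (b * real n powr c))"
proof -
  define d where "d = nat \<lfloor>c\<rfloor>"
  have d: "real d = of_int \<lfloor>c\<rfloor>" using c by (simp add: d_def)
  \<comment> \<open>\<open>s\<close> is the fractional part of \<open>c\<close>, and differences of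
    order \<open>Suc d\<close> have exponent \<open>c - (d + 1) = s - 1\<close>. As \<open>c\<close>
    is not an integer, \<open>s\<close> is positive and no factor \<open>c - i\<close>
    vanishes.\<close>
  define s where "s = c - real d"
  have "frac c > 0" using c by (simp add: frac_gt_0_iff)
  then have s: "0 < s" "s < 1" using frac_lt_1[of c] by (auto simp: s_def d frac_def)
  have "c - real i \<noteq> 0" for i
    using c by (metis Ints_of_nat eq_iff_diff_eq_0)
  then have ne: "b * (\<Prod>i<Suc d. c - real i) \<noteq> 0" using b by (simp only: mult_eq_0_iff prod_zero_iff finite_lessThan) auto
  show ?thesis
  proof (rule null_mean_cis_sdiff[OF s ne])
    show "(\<lambda>n. (sdiff ^^ Suc d) (\<lambda>n. b * real n powr c) n / real n powr (s - 1)) \<longlonglongrightarrow> b * (\<Prod>i<Suc d. c - real i)"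
      using sdiff_powr_asymp[of "Suc d" b c] by (simp add: s_def algebra_simps del: funpow.simps prod.lessThan_Suc)
    show "(\<lambda>n. (sdiff ^^ Suc (Suc d)) (\<lambda>n. b * real n powr c) n / real n powr (s - 2)) \<longlonglongrightarrow> b * (\<Prod>i<Suc (Suc d). c - real i)"
      using sdiff_powr_asymp[of "Suc (Suc d)" b c] by (simp add: s_def algebra_simps del: funpow.simps prod.lessThan_Suc)
  qed
qed

section \<open>Indicators of arcs\<close>

text \<open>All powers \<open>z ^ j\<close> with \<open>j < J\<close> stay within 1/2 of 1, so they
  cannot cancel.\<close>

lemma norm_sum_powers_ge:
  fixes z :: complex
  assumes "norm z = 1" "norm (1 - z) \<le> 1 / (2 * real J)"
  shows "norm (\<Sum>j<J. z ^ j) \<ge> real J / 2"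
proof -
  have "norm (1 - z ^ j) \<le> real j * norm (1 - z)" for j
    using norm_power_diff[of 1 z j] assms(1) by simp
  then have "norm (1 - z ^ j) \<le> 1 / 2" if "j < J" for j
  proof -
    have "norm (1 - z ^ j) \<le> real J * (1 / (2 * real J))"
      using that assms(2) by (intro order_trans[OF \<open>norm (1 - z ^ j) \<le> real j * norm (1 - z)\<close>] mult_mono) auto
    then show ?thesis using that by simp
  qed
  then have "norm (\<Sum>j<J. 1 - z ^ j) \<le> (\<Sum>j<J. 1 / 2)" by (intro sum_norm_le) auto
  then have "norm (of_nat J - (\<Sum>j<J. z ^ j)) \<le> real J / 2" by (simp add: sum_subtractf)
  then show ?thesis
    using norm_triangle_sub[of "of_nat J :: complex" "\<Sum>j<J. z ^ j"] by simp
qed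

text \<open>The upper bound in Weyl's criterion. The squared norm of the sum of the first
  \<open>J\<close> powers of \<open>cis (x n - y)\<close> is at least \<open>J^2 / 4\<close> near
  \<open>y\<close>, while its mean is at most about \<open>2 * J\<close>, so a small arc has density
  at most \<open>8 / J\<close>. Measuring distance by chords avoids reducing angles modulo
  \<open>2 * pi\<close>.\<close>

lemma density_near_point:
  fixes x :: "nat \<Rightarrow> real"
  assumes x: "\<And>k::int. k \<noteq> 0 \<Longrightarrow> null_mean (\<lambda>n. cis (of_int k * x n))" and "e > 0"
  shows "\<exists>r>0. \<exists>B. \<forall>N. (\<Sum>n<N. of_bool (norm (1 - cis (x n - y)) \<le> r)) \<le> e * real N + B"
proof -
  obtain J0 :: nat where "real J0 > 8 / e" using reals_Archimedean2 by blast
  then obtain J :: nat where J: "real J \<ge> 8 / e" "real J > 0"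
    using \<open>e > 0\<close> by (metis divide_pos_pos less_eq_real_def order_less_trans zero_less_numeral)
  have null: "null_mean (\<lambda>n. cis (x n - y) ^ i * cnj (cis (x n - y) ^ j))" if "i \<noteq> j" for i j :: nat
  proof -
    have "null_mean (\<lambda>n. cis (- (of_int (int i - int j) * y)) * cis (of_int (int i - int j) * x n))"
      using that by (intro null_mean_cmult x) auto
    moreover have "cis (- (of_int (int i - int j) * y)) * cis (of_int (int i - int j) * x n)
        = cis (x n - y) ^ i * cnj (cis (x n - y) ^ j)" for n
    proof -
      have "cis (x n - y) ^ i = cis (real i * (x n - y))" by (rule Complex.DeMoivre)
      moreover have "cnj (cis (x n - y) ^ j) = cis (- (real j * (x n - y)))"
        unfolding Complex.DeMoivre by (rule cis_cnj)
      ultimately show ?thesis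
        by (simp only: cis_mult) (rule arg_cong[of _ _ cis], simp add: algebra_simps)
    qed
    ultimately show ?thesis by simp
  qed
  have "1 / real J > 0" using J by simp
  then obtain B where *: "\<forall>i j. B i j \<ge> 0 \<and> (i \<in> UNIV \<and> j \<in> UNIV \<and> i \<noteq> j \<longrightarrow>
      (\<forall>N. norm (\<Sum>n<N. cis (x n - y) ^ i * cnj (cis (x n - y) ^ j)) \<le> 1 / real J * real N + B i j))"
    using exE[OF null_mean_off_diagonal[of UNIV "\<lambda>i j n. cis (x n - y) ^ i * cnj (cis (x n - y) ^ j)", OF null]] by blast
  have B0: "B i j \<ge> 0" for i j using * by blast
  have B: "i \<noteq> j \<Longrightarrow> norm (\<Sum>n<N. cis (x n - y) ^ i * cnj (cis (x n - y) ^ j)) \<le> 1 / real J * real N + B i j" for i j N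
    using * by blast
  define C where "C = (\<Sum>i<J. \<Sum>j<J. B i j)"
  have "(\<Sum>n<N. of_bool (norm (1 - cis (x n - y)) \<le> 1 / (2 * real J))) \<le> e * real N + 4 * C / (real J)\<^sup>2" for N
  proof -
    have "(\<Sum>n<N. of_bool (norm (1 - cis (x n - y)) \<le> 1 / (2 * real J))) * ((real J)\<^sup>2 / 4)
        = (\<Sum>n<N. of_bool (norm (1 - cis (x n - y)) \<le> 1 / (2 * real J)) * (real J / 2)\<^sup>2)"
      by (simp add: sum_distrib_right power_divide)
    also have "\<dots> \<le> (\<Sum>n<N. (norm (\<Sum>j<J. cis (x n - y) ^ j))\<^sup>2)"
    proof (rule sum_mono)
      fix n
      show "of_bool (norm (1 - cis (x n - y)) \<le> 1 / (2 * real J)) * (real J / 2)\<^sup>2 \<le> (norm (\<Sum>j<J. cis (x n - y) ^ j))\<^sup>2"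
        using norm_sum_powers_ge[of "cis (x n - y)" J]
        by (cases "norm (1 - cis (x n - y)) \<le> 1 / (2 * real J)") (auto intro: power_mono)
    qed
    also have "\<dots> \<le> (\<Sum>i<J. \<Sum>j<J. norm (\<Sum>n<N. cis (x n - y) ^ i * cnj (cis (x n - y) ^ j)))"
      by (rule sum_norm_sum_square_le)
    also have "\<dots> \<le> (\<Sum>i<J. real N) + (\<Sum>i<J. \<Sum>j<J. 1 / real J * real N + B i j)"
    proof (rule sum_sum_norm_le_diagonal)
      fix i
      show "norm (\<Sum>n<N. cis (x n - y) ^ i * cnj (cis (x n - y) ^ i)) \<le> real N"
        using sum_norm_le[of "{..<N}" "\<lambda>n. cis (x n - y) ^ i * cnj (cis (x n - y) ^ i)" "\<lambda>_. 1"]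
        by (simp add: norm_mult norm_power)
    qed (use B B0 in auto)
    also have "\<dots> = 2 * real J * real N + C"
      using J by (simp add: sum.distrib C_def)
    finally have "(\<Sum>n<N. of_bool (norm (1 - cis (x n - y)) \<le> 1 / (2 * real J))) \<le> (2 * real J * real N + C) / ((real J)\<^sup>2 / 4)"
      using J by (subst pos_le_divide_eq) auto
    also have "\<dots> = 8 / real J * real N + 4 * C / (real J)\<^sup>2"
      using J by (simp add: field_simps power2_eq_square)
    also have "8 / real J * real N \<le> e * real N"
      using J \<open>e > 0\<close> by (intro mult_right_mono) (auto simp: field_simps)
    finally show ?thesis by simp
  qed
  moreover have "1 / (2 * real J) > 0" using J by simp
  ultimately show ?thesis by blast
qed

text \<open>The cosine is a combination of the frequencies 1 and -1, so each factor shifts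
  \<open>k\<close> by one in both directions; hence the induction over all \<open>k\<close> at
  once.\<close>

lemma null_mean_mult_cos_power:
  assumes "\<And>k::int. null_mean (\<lambda>n. F n * cis (of_int k * x n))"
  shows "null_mean (\<lambda>n. F n * cis (of_int k * x n) * complex_of_real (cos (x n - y)) ^ i)"
proof (induction i arbitrary: k)
  case 0
  then show ?case using assms by simp
next
  case (Suc i)
  have "null_mean (\<lambda>n. (cis (-y) / 2) * (F n * cis (of_int (k + 1) * x n) * complex_of_real (cos (x n - y)) ^ i)
      + (cis y / 2) * (F n * cis (of_int (k - 1) * x n) * complex_of_real (cos (x n - y)) ^ i))"
    by (intro null_mean_add null_mean_cmult Suc)
  moreover have "(cis (-y) / 2) * (F n * cis (of_int (k + 1) * x n) * complex_of_real (cos (x n - y)) ^ i)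
      + (cis y / 2) * (F n * cis (of_int (k - 1) * x n) * complex_of_real (cos (x n - y)) ^ i)
      = F n * cis (of_int k * x n) * complex_of_real (cos (x n - y)) ^ Suc i" for n
  proof -
    have "cis (of_int (k + 1) * x n) = cis (of_int k * x n) * cis (x n)"
      "cis (of_int (k - 1) * x n) = cis (of_int k * x n) * cis (- x n)"
      by (simp_all add: cis_mult algebra_simps)
    moreover have "complex_of_real (cos (x n - y)) = (cis (- y) * cis (x n) + cis y * cis (- x n)) / 2"
      by (simp add: cis_mult complex_eq_iff cos_diff sin_diff)
    ultimately show ?thesis by (simp add: algebra_simps add_divide_distrib)
  qed
  ultimately show ?case by simp
qed

text \<open>Treats both endpoints of an arc at once: if \<open>cos u\<close> is close to
  \<open>cos a\<close>, then \<open>u\<close> is close to \<open>a\<close> or to \<open>- a\<close>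
  modulo \<open>2 * pi\<close>.\<close>

lemma norm_one_minus_cis_mult:
  "norm (1 - cis (u + a)) * norm (1 - cis (u - a)) = 2 * \<bar>cos u - cos a\<bar>"
proof -
  have "(1 - cis (u + a)) * (1 - cis (u - a)) = 1 + cis u * cis u - cis u * (cis a + cis (- a))"
    by (simp add: algebra_simps cis_mult)
  also have "\<dots> = cis u * ((cis u + cis (- u)) - (cis a + cis (- a)))"
    by (simp add: algebra_simps cis_mult)
  also have "(cis u + cis (- u)) - (cis a + cis (- a)) = complex_of_real (2 * (cos u - cos a))"
    by (simp add: complex_eq_iff)
  finally have "norm ((1 - cis (u + a)) * (1 - cis (u - a))) = norm (cis u * complex_of_real (2 * (cos u - cos a)))"
    by simp
  then show ?thesis by (simp only: norm_mult norm_cis norm_of_real abs_mult abs_numeral mult_1_left)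
qed

text \<open>An arc is a superlevel set of a cosine, so its indicator is a step function of
  \<open>cos (x n - y)\<close>, and Weierstrass approximation on the interval from -1 to 1 yields
  trigonometric polynomials. The \<open>n\<close> near an endpoint have small density. The weak
  inequalities let endpoints lie on either side.\<close>

lemma null_mean_mult_cos_indicator:
  fixes F :: "nat \<Rightarrow> complex" and x :: "nat \<Rightarrow> real" and A :: "nat \<Rightarrow> bool"
  assumes F: "\<And>n. norm (F n) \<le> 1"
    and Fx: "\<And>k::int. null_mean (\<lambda>n. F n * cis (of_int k * x n))"
    and x: "\<And>k::int. k \<noteq> 0 \<Longrightarrow> null_mean (\<lambda>n. cis (of_int k * x n))"
    and A: "\<And>n. A n \<Longrightarrow> cos (x n - y) \<ge> cos a" "\<And>n. \<not> A n \<Longrightarrow> cos (x n - y) \<le> cos a"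
  shows "null_mean (\<lambda>n. F n * of_bool (A n))"
proof (rule null_mean_approx)
  fix e :: real assume "e > 0"
  \<comment> \<open>One third goes to the polynomial approximation and one to each endpoint.\<close>
  then have e: "e / 3 > 0" by simp
  obtain r1 B1 where r1: "r1 > 0" and
    B1: "\<And>N. (\<Sum>n<N. of_bool (norm (1 - cis (x n - (y - a))) \<le> r1)) \<le> e / 3 * real N + B1"
    using density_near_point[OF x e] by metis
  obtain r2 B2 where r2: "r2 > 0" and
    B2: "\<And>N. (\<Sum>n<N. of_bool (norm (1 - cis (x n - (y + a))) \<le> r2)) \<le> e / 3 * real N + B2"
    using density_near_point[OF x e] by metis
  \<comment> \<open>If the two chords exceed \<open>r1\<close> and \<open>r2\<close>, the product
    identity makes the distance from \<open>cos (x n - y)\<close> to \<open>cos a\<close> at least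
    \<open>r1 * r2 / 2\<close>.\<close>
  define r where "r = r1 * r2 / 2"
  have r: "r > 0" using r1 r2 by (simp add: r_def)
  \<comment> \<open>A continuous ramp which agrees with the indicator unless cos (x n - y) is within r of cos a.\<close>
  define h where "h = (\<lambda>t. max 0 (min 1 ((t - cos a) / r)))"
  have "continuous_on {-1..1} h" unfolding h_def using r by (intro continuous_intros) auto
  then obtain q where q: "real_polynomial_function q" and qh: "\<And>t. t \<in> {-1..1} \<Longrightarrow> \<bar>h t - q t\<bar> < e / 3"
    using Stone_Weierstrass_real_polynomial_function[of "{-1..1::real}" h "e / 3"] e by auto
  obtain c d where cd: "q = (\<lambda>t. \<Sum>i\<le>d. c i * t ^ i)"
    using q by (auto simp: real_polynomial_function_iff_sum)
  define v where "v = (\<lambda>n. F n * complex_of_real (q (cos (x n - y))))"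
  have "null_mean (\<lambda>n. \<Sum>i\<le>d. complex_of_real (c i) * (F n * cis (of_int 0 * x n) * complex_of_real (cos (x n - y)) ^ i))"
    by (intro null_mean_sum null_mean_cmult null_mean_mult_cos_power Fx) auto
  then have v: "null_mean v"
    by (simp add: v_def cd sum_distrib_left mult_ac)
  have pt: "norm (F n * of_bool (A n) - v n) \<le> e / 3
      + of_bool (norm (1 - cis (x n - (y - a))) \<le> r1) + of_bool (norm (1 - cis (x n - (y + a))) \<le> r2)" for n
  proof -
    define t where "t = cos (x n - y)"
    have t: "t \<in> {-1..1}" by (simp add: t_def)
    have "\<bar>of_bool (A n) - h t\<bar> \<le> of_bool (\<bar>t - cos a\<bar> < r)"
    proof (cases "A n")
      case True
      then show ?thesis using A(1)[OF True] r by (auto simp: h_def t_def max_def min_def field_simps)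
    next
      case False
      have "(t - cos a) / r \<le> 0" using A(2)[OF False] r by (simp add: t_def divide_nonpos_pos)
      then show ?thesis using False by (simp add: h_def)
    qed
    also have "\<dots> \<le> of_bool (norm (1 - cis (x n - (y - a))) \<le> r1) + of_bool (norm (1 - cis (x n - (y + a))) \<le> r2)"
    proof -
      have "norm (1 - cis (x n - (y - a))) \<le> r1 \<or> norm (1 - cis (x n - (y + a))) \<le> r2" if "\<bar>t - cos a\<bar> < r"
      proof (rule ccontr)
        assume "\<not> ?thesis"
        then have "r1 * r2 \<le> norm (1 - cis (x n - (y - a))) * norm (1 - cis (x n - (y + a)))"
          using r1 r2 by (intro mult_mono) auto
        also have "\<dots> = 2 * \<bar>t - cos a\<bar>"
          using norm_one_minus_cis_mult[of "x n - y" a] by (simp add: t_def algebra_simps)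
        finally show False using that by (simp add: r_def)
      qed
      then show ?thesis by auto
    qed
    finally have "\<bar>of_bool (A n) - q t\<bar> \<le> e / 3
      + of_bool (norm (1 - cis (x n - (y - a))) \<le> r1) + of_bool (norm (1 - cis (x n - (y + a))) \<le> r2)"
      using qh[OF t] by linarith
    moreover have "norm (F n * of_bool (A n) - v n) \<le> \<bar>of_bool (A n) - q t\<bar>"
    proof -
      have "F n * of_bool (A n) - v n = F n * complex_of_real (of_bool (A n) - q t)"
        by (simp add: v_def t_def algebra_simps)
      then have "norm (F n * of_bool (A n) - v n) = norm (F n) * \<bar>of_bool (A n) - q t\<bar>"
        by (simp only: norm_mult norm_of_real)
      then show ?thesis using F[of n] by (simp add: mult_left_le_one_le)
    qed
    ultimately show ?thesis by linarith
  qed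
  have "(\<Sum>n<N. norm (F n * of_bool (A n) - v n)) \<le> e * real N + (B1 + B2)" for N
  proof -
    have "(\<Sum>n<N. norm (F n * of_bool (A n) - v n)) \<le> (\<Sum>n<N. e / 3
      + of_bool (norm (1 - cis (x n - (y - a))) \<le> r1) + of_bool (norm (1 - cis (x n - (y + a))) \<le> r2))"
      by (intro sum_mono pt)
    also have "\<dots> = e / 3 * real N + (\<Sum>n<N. of_bool (norm (1 - cis (x n - (y - a))) \<le> r1))
        + (\<Sum>n<N. of_bool (norm (1 - cis (x n - (y + a))) \<le> r2))"
      by (simp only: sum.distrib sum_constant card_lessThan) simp
    finally show ?thesis using B1[of N] B2[of N] by simp
  qed
  then show "\<exists>v B. null_mean v \<and> (\<forall>N. (\<Sum>n<N. norm (F n * of_bool (A n) - v n)) \<le> e * real N + B)"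
    using v by blast
qed

text \<open>The residue \<open>j\<close> corresponds to an arc of angle \<open>2 * pi / m\<close>
  with midpoint coming from \<open>j + 1/2\<close>, and \<open>pi / m\<close> is half its
  width.\<close>

lemma floor_mod_arc:
  fixes t :: real and m j :: nat
  assumes "t \<ge> 0" "m > 0" "j < m"
  defines "u \<equiv> 2 * pi * t / real m - 2 * pi * (real j + 1/2) / real m"
  shows "nat \<lfloor>t\<rfloor> mod m = j \<Longrightarrow> cos u \<ge> cos (pi / real m)"
    and "nat \<lfloor>t\<rfloor> mod m \<noteq> j \<Longrightarrow> cos u \<le> cos (pi / real m)"
proof -
  define n where "n = nat \<lfloor>t\<rfloor>"
  define i where "i = n mod m"
  define s where "s = t - real n"
  have s: "0 \<le> s" "s < 1" using assms(1) by (auto simp: s_def n_def) linarith+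
  have i: "i < m" using assms(2) by (simp add: i_def)
  have n: "real n = real i + real m * real (n div m)"
    unfolding i_def by (metis add.commute div_mult_mod_eq mult.commute of_nat_add of_nat_mult)
  \<comment> \<open>The offset of \<open>t\<close> from the midpoint \<open>j + 1/2\<close>, after
    removal of the full periods of length \<open>m\<close>.\<close>
  define b where "b = real i - real j + s - 1/2"
  have u: "u = 2 * pi * b / real m + 2 * pi * real (n div m)"
    using assms(2) by (simp add: u_def b_def s_def n field_simps)
  then have cos_u: "cos u = cos (2 * pi * b / real m)" 
    using cos.plus_of_nat[of "2 * pi * b / real m" "n div m"] by (simp add: mult_ac)
  have pim: "0 \<le> pi / real m" "pi / real m \<le> pi" using assms(2) by (auto simp: field_simps)
  {
    assume "nat \<lfloor>t\<rfloor> mod m = j"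
    then have "b = s - 1/2" by (simp add: b_def i_def n_def)
    then have "2 * \<bar>b\<bar> \<le> 1" using s by (simp add: abs_if)
    then have "pi * (2 * \<bar>b\<bar>) \<le> pi" using pi_ge_zero by (rule mult_left_le[of _ pi])
    then have "\<bar>2 * pi * b / real m\<bar> \<le> pi / real m"
      using assms(2) by (simp add: abs_mult mult_ac divide_right_mono)
    then have "cos \<bar>2 * pi * b / real m\<bar> \<ge> cos (pi / real m)"
      using pim by (intro cos_monotone_0_pi_le) auto
    then show "cos u \<ge> cos (pi / real m)" by (simp only: cos_u cos_abs_real)
  }
  {
    assume "nat \<lfloor>t\<rfloor> mod m \<noteq> j"
    then have ij: "i \<noteq> j" by (simp add: i_def n_def)
    \<comment> \<open>The lower bound puts the angle outside the arc; the upper one keeps it at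
      least \<open>pi / m\<close> short of a full turn, where the arc would be entered
      again.\<close>
    have far: "1/2 \<le> \<bar>b\<bar>" "\<bar>b\<bar> \<le> real m - 1/2"
      using ij i assms(3) s by (auto simp: b_def abs_real_def)
    define w where "w = 2 * pi * \<bar>b\<bar> / real m"
    have "pi * (1 + 2 * \<bar>b\<bar>) \<le> pi * (2 * real m)" using far by (intro mult_left_mono) auto
    then have w: "pi / real m \<le> w" "w \<le> 2 * pi - pi / real m"
      using far assms(2) by (simp_all add: w_def field_simps)
    have "cos u = cos \<bar>2 * pi * b / real m\<bar>" by (simp only: cos_u cos_abs_real)
    also have "\<bar>2 * pi * b / real m\<bar> = w" by (simp add: w_def abs_mult)
    also have "cos w \<le> cos (pi / real m)"
    \<comment> \<open>Cosine decreases from 0 to \<open>pi\<close>; beyond \<open>pi\<close> the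
      angle is reflected to \<open>2 * pi - w\<close>.\<close>
    proof (cases "w \<le> pi")
      case True
      then show ?thesis using w pim by (intro cos_monotone_0_pi_le) auto
    next
      case False
      have "cos w = cos (2 * pi - w)" by (simp add: cos_diff)
      also have "\<dots> \<le> cos (pi / real m)"
        using False w pim by (intro cos_monotone_0_pi_le) auto
      finally show ?thesis .
    qed
    finally show "cos u \<le> cos (pi / real m)" .
  }
qed

theorem theorem4:
  fixes c :: real and m :: nat and G :: "nat \<Rightarrow> complex"
  assumes "c > 1" and "c \<notin> \<int>" and "m \<ge> 2"
  shows "\<forall>f :: nat \<Rightarrow> complex.
           multiplicative_fun f
           \<and> (\<forall>n>0. norm (f n) \<le> 1)
           \<and> (\<lambda>N. \<Sum>n\<in>{1..<N}. f n) \<in> o(\<lambda>N. complex_of_real (real N))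
           \<longrightarrow> (\<lambda>N. \<Sum>n\<in>{1..<N}. f n * G (nat \<lfloor>real n powr c\<rfloor> mod m))
               \<in> o(\<lambda>N. complex_of_real (real N))"
proof (intro allI impI, elim conjE)
  fix f :: "nat \<Rightarrow> complex"
  assume mult: "multiplicative_fun f" and bound: "\<forall>n>0. norm (f n) \<le> 1"
    and mean: "(\<lambda>N. \<Sum>n\<in>{1..<N}. f n) \<in> o(\<lambda>N. complex_of_real (real N))"
  \<comment> \<open>Nothing is assumed about f 0.\<close>
  define F where "F = (\<lambda>n. if n = 0 then 0 else f n)"
  have sum_F: "(\<Sum>n<N. F n * v n) = (\<Sum>n\<in>{1..<N}. f n * v n)" for N v
    by (rule sum.mono_neutral_cong_right) (auto simp: F_def)
  have F: "norm (F n) \<le> 1" for n using bound by (simp add: F_def)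
  have F_mult: "F (p * k) = F p * F k" if "prime p" "\<not> p dvd k" for p k
  proof -
    \<comment> \<open>Every prime divides 0, so \<open>k\<close> is positive and the value chosen
      for \<open>F 0\<close> does not interfere.\<close>
    have "p > 0" "k > 0" using that by (auto simp: prime_gt_0_nat intro!: gr0I)
    moreover have "coprime p k" using that by (simp add: prime_imp_coprime)
    ultimately show ?thesis using mult by (simp add: F_def multiplicative_fun_def)
  qed
  define x where "x = (\<lambda>n. 2 * pi * real n powr c / real m)"
  have cis_x: "null_mean (\<lambda>n. cis (b * x n))" if "b \<noteq> 0" for b
    using null_mean_cis_powr[OF assms(1,2), of "b * (2 * pi / real m)"] that assms(3)
    by (simp add: x_def mult_ac)
  have F_cis: "null_mean (\<lambda>n. F n * cis (of_int k * x n))" for k :: int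
  proof (cases "k = 0")
    case True
    then show ?thesis using mean sum_F[of "\<lambda>_. 1"] by (simp add: null_mean_iff_smallo)
  next
    case False
    show ?thesis
    proof (rule Katai_criterion[OF F _ F_mult])
      fix p q :: nat assume pq: "prime p" "prime q" "p \<noteq> q"
      \<comment> \<open>Powers with exponent \<open>c\<close> are strictly increasing, so the
        correlation phase is again a nonzero multiple of \<open>x\<close>.\<close>
      have "real p powr c \<noteq> real q powr c"
        using pq assms(1) by (metis linorder_neqE_nat of_nat_0_le_iff of_nat_less_iff order_less_irrefl
            order_less_trans powr_less_mono2 zero_less_one)
      then have "of_int k * (real p powr c - real q powr c) \<noteq> 0" using False by simp
      from cis_x[OF this]
      show "null_mean (\<lambda>j. cis (of_int k * x (p * j)) * cnj (cis (of_int k * x (q * j))))"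
        by (simp add: cis_cnj cis_mult x_def powr_mult diff_divide_distrib algebra_simps)
    qed simp
  qed
  have "null_mean (\<lambda>n. F n * of_bool (nat \<lfloor>real n powr c\<rfloor> mod m = j))" if "j < m" for j
  proof (rule null_mean_mult_cos_indicator[OF F F_cis])
    show "null_mean (\<lambda>n. cis (of_int k * x n))" if "k \<noteq> 0" for k :: int
      using that by (intro cis_x) simp
  next
    fix n
    let ?y = "2 * pi * (real j + 1/2) / real m"
    show "cos (x n - ?y) \<ge> cos (pi / real m)" if "nat \<lfloor>real n powr c\<rfloor> mod m = j"
      unfolding x_def using that assms(3) \<open>j < m\<close> by (intro floor_mod_arc) auto
    show "cos (x n - ?y) \<le> cos (pi / real m)" if "nat \<lfloor>real n powr c\<rfloor> mod m \<noteq> j"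
      unfolding x_def using that assms(3) \<open>j < m\<close> by (intro floor_mod_arc) auto
  qed
  \<comment> \<open>On residues below \<open>m\<close>, \<open>G\<close> is a finite linear
    combination of indicators.\<close>
  then have "null_mean (\<lambda>n. \<Sum>j<m. G j * (F n * of_bool (nat \<lfloor>real n powr c\<rfloor> mod m = j)))"
    by (intro null_mean_sum null_mean_cmult) auto
  moreover have "(\<Sum>j<m. G j * (F n * of_bool (nat \<lfloor>real n powr c\<rfloor> mod m = j)))
      = F n * G (nat \<lfloor>real n powr c\<rfloor> mod m)" for n
  proof -
    have "(\<Sum>j<m. G j * (F n * of_bool (nat \<lfloor>real n powr c\<rfloor> mod m = j)))
        = (\<Sum>j<m. if nat \<lfloor>real n powr c\<rfloor> mod m = j then G j * F n else 0)"
      by (intro sum.cong) auto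
    then show ?thesis using assms(3) by simp
  qed
  ultimately have "null_mean (\<lambda>n. F n * G (nat \<lfloor>real n powr c\<rfloor> mod m))" by simp
  then show "(\<lambda>N. \<Sum>n\<in>{1..<N}. f n * G (nat \<lfloor>real n powr c\<rfloor> mod m)) \<in> o(\<lambda>N. complex_of_real (real N))"
    by (simp add: null_mean_iff_smallo sum_F)
qed

end
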